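(* Let $X\subset\mathbb{C}$ be a compact set with empty interior, let $x_0\in X$, let $t$ be a positive integer, and let $2<p<\infty$. Suppose that there exists a bounded point derivation of order $t$ on $R^p(X)$ at $x_0$, denoted by $D_{x_0}^t$. Then, given a function $f$ in $R^p(X)$, there exists a set $E'\subset\mathbb{C}$ with full area density at $0$ (with $x_0+sh\in X$ for all $h\in E'$ and $s=1,\dots,t$, so that the difference quotients below are defined) such that $$\lim_{h\to 0,\ h\in E'}\left|\Delta_h^t f(x_0)-D_{x_0}^t f\right|=0 .$$
   Context: $m$ (or $dA$) denotes 2-dimensional Lebesgue (area) measure on $\mathbb{C}$. For compact $X\subset\mathbb{C}$ and $1\le p<\infty$, $R^p(X)$ is the closure in $L^p(X,dA)$ of the rational functions with poles off $X$; $\|\cdot\|_p$ is the norm of $L^p(X,dA)$. For an integer $t\ge 0$, $R^p(X)$ has a bounded point derivation of order $t$ at $x_0\in X$ if there is a constant $C>0$ with $|F^{(t)}(x_0)|\le C\|F\|_p$ for all rational functions $F$ with poles off $X$ (with $F^{(0)}=F$; order $0$ is called a bounded point evaluation). In that case $F\mapsto F^{(t)}(x_0)$ extends uniquely to a bounded linear functional $D_{x_0}^t$ on $R^p(X)$: $D_{x_0}^t f=\lim_{j} f_j^{(t)}(x_0)$ for any sequence $\{f_j\}$ of rational functions with poles off $X$ converging to $f$ in $L^p$. Existence of a bounded point derivation of order $t$ at $x_0$ implies existence of those of all orders $0\le m\le t$ at $x_0$. The $t$-th order difference quotient of $f$ at $x_0$ and $h\ne 0$ (for $h\in\mathbb{C}$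 such that $f$ is defined at $x_0+sh$, $s=0,1,\dots,t$) is $$\Delta_h^t f(x_0)=h^{-t}\sum_{s=0}^{t}(-1)^{t-s}\binom{t}{s}f(x_0+sh).$$ A (Lebesgue measurable) set $E'\subset\mathbb{C}$ has full area density at $0$ if $\lim_{n\to\infty}\frac{m(\Delta_n(0)\setminus E')}{m(\Delta_n(0))}=0$, where $\Delta_n(0)$ is the disc in $\mathbb{C}$ centered at $0$ of radius $1/n$. Convention on values: an element $f\in R^p(X)$ is an $L^p$ class; $f(x_0)$ means $D_{x_0}^0 f$, and for $x\ne x_0$, $f(x)$ is the value of a fixed representative of $f$ (the set $E'$ may depend on $f$ and the representative). The limit is over $h\in E'$, $h\ne0$. *)

theory Defs
  imports "HOL-Analysis.Analysis" "HOL-Computational_Algebra.Polynomial"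
begin

(* Elements of L^p(X, dA) are represented by total functions; only their values on X matter,
   and no quotient by almost-everywhere equality is taken. *)
definition Lp_fun :: "complex set \<Rightarrow> real \<Rightarrow> (complex \<Rightarrow> complex) set" where
  "Lp_fun X p = {f \<in> borel_measurable (lebesgue_on X).
     integrable (lebesgue_on X) (\<lambda>z. norm (f z) powr p)}"

(* Meaningful on Lp_fun X p only: the Bochner integral of a non-integrable function is 0. *)
definition Lp_norm :: "complex set \<Rightarrow> real \<Rightarrow> (complex \<Rightarrow> complex) \<Rightarrow> real" where
  "Lp_norm X p f = (LINT z|lebesgue_on X. norm (f z) powr p) powr (1 / p)"

definition rational_off :: "complex set \<Rightarrow> (complex \<Rightarrow> complex) set" where
  "rational_off X = {F. \<exists>P Q. (\<forall>z\<in>X. poly Q z \<noteq> 0) \<and> Q \<noteq> 0 \<and> F = (\<lambda>z. poly P z / poly Q z)}"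

definition Rp :: "complex set \<Rightarrow> real \<Rightarrow> (complex \<Rightarrow> complex) set" where
  "Rp X p = {f \<in> Lp_fun X p. \<forall>\<epsilon>>0. \<exists>F\<in>rational_off X. Lp_norm X p (\<lambda>z. F z - f z) < \<epsilon>}"

definition has_bounded_point_derivation :: "complex set \<Rightarrow> real \<Rightarrow> nat \<Rightarrow> complex \<Rightarrow> bool" where
  "has_bounded_point_derivation X p t x0 \<longleftrightarrow>
     (\<exists>C>0. \<forall>F\<in>rational_off X. norm ((deriv ^^ t) F x0) \<le> C * Lp_norm X p F)"

(* The extended functional D_{x0}^t f; the limit is well defined when f lies in R^p(X) and
   there is a bounded point derivation of order t at x0. *)
definition point_derivation ::
  "complex set \<Rightarrow> real \<Rightarrow> nat \<Rightarrow> complex \<Rightarrow> (complex \<Rightarrow> complex) \<Rightarrow> complex" where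
  "point_derivation X p t x0 f = (THE L. \<forall>F :: nat \<Rightarrow> complex \<Rightarrow> complex.
     (\<forall>j. F j \<in> rational_off X) \<longrightarrow>
     (\<lambda>j. Lp_norm X p (\<lambda>z. F j z - f z)) \<longlonglongrightarrow> 0 \<longrightarrow>
     (\<lambda>j. (deriv ^^ t) (F j) x0) \<longlonglongrightarrow> L)"

definition diff_quotient :: "nat \<Rightarrow> complex \<Rightarrow> (complex \<Rightarrow> complex) \<Rightarrow> complex \<Rightarrow> complex" where
  "diff_quotient t h f x0 =
     inverse (h ^ t) * (\<Sum>s=0..t. (-1) ^ (t - s) * of_nat (t choose s) * f (x0 + of_nat s * h))"

definition full_area_density_at_0 :: "complex set \<Rightarrow> bool" where
  "full_area_density_at_0 E \<longleftrightarrow> E \<in> sets lebesgue \<and>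
     (\<lambda>n. measure lebesgue (ball 0 (1 / real n) - E) / measure lebesgue (ball (0::complex) (1 / real n)))
       \<longlonglongrightarrow> 0"

end

theory Submission
  imports Defs "HOL-Complex_Analysis.Complex_Analysis"
begin

text \<open>
  Write $u = y - x_0$. Off an exceptional set that is thin at $x_0$, a function $f \in R^p(X)$ has an
  order $t$ Taylor expansion at $x_0$,
  $$f(y) = \sum_{m \le t} a_m u^m + o(|u|^t), \qquad a_m = D_{x_0}^m f / m!.$$
  The order $t$ difference quotient maps the polynomial to $t!\,a_t = D_{x_0}^t f$ and the
  remainder to a quantity tending to $0$, and this gives the theorem
  (\<open>diff_quotient_polynomial\<close>, \<open>norm_diff_quotient_le\<close>). The expansion comes about as follows.

  The functional $F \mapsto F^{(t)}(x_0)/t!$ is bounded in the $L^p$ norm on the rational functions,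
  so it is $F \mapsto \int F K\,dA$ for some $K \in L^q(X)$, $q = p/(p-1)$. The kernel is found by
  minimising $\int |F|^p$ over the $F$ on which the functional equals $1$: Clarkson's inequality makes
  minimising sequences converge, and the first variation at the limit $g$ says that
  $|g|^{p-2} \overline g$ annihilates the kernel of the functional
  (\<open>Lp_subspace_functional_representation\<close>).

  For rational $F$ and $y \in X$ the function $(z-x_0)^{t+1} (F(z)-F(y))/(z-y)$ is rational with
  poles off $X$ and vanishes to order $t+1$ at $x_0$, so its integral against $K$ is $0$. Expanding
  $$\frac{(z-x_0)^{t+1}}{z-y} = \sum_{m \le t} u^m (z-x_0)^{t-m} + \frac{u^{t+1}}{z-y}$$
  turns this into
  $$F(y)\,\bigl(1 + u^{t+1} \widehat K(y)\bigr) = \sum_{m \le t} a_m u^m + u^{t+1}\,\widehat{FK}(y),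
    \qquad \widehat H(y) = \int_X \frac{H(z)}{z-y}\,dA(z),$$
  which passes to $f \in R^p(X)$ for almost every $y \in X$ (\<open>taylor_identity_AE\<close>). The same computation
  with $1/(z-y)$ for $y \notin X$ gives $1 + u^{t+1} \widehat K(y) = 0$, so that points outside $X$
  are exceptional.

  Everything is reduced to the smallness of $u \widehat H(y)$ for the integrable functions $H = K$
  and $H = fK$. By Fubini's theorem and dominated convergence the average of
  $|u| \int |H(z)|/|z-y|\,dA(z)$ over discs around $x_0$ tends to $0$ with the radius
  (\<open>cauchy_potential_average_tendsto_0\<close>), so the sets where it exceeds $1/n$ have density $0$ at
  $x_0$, and a diagonal construction produces one set of full density along which it tends to $0$
  (\<open>density_point_diagonal\<close>).
\<close>

section \<open>Inequalities for real powers\<close>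

text \<open>
  Each of $x, y$ is a fraction $\lambda \le 1$ of $x + y$, and $\lambda^q \le \lambda$.
\<close>
lemma powr_superadd:
  fixes x y :: real
  assumes "0 \<le> x" "0 \<le> y" "1 \<le> q"
  shows "x powr q + y powr q \<le> (x + y) powr q"
proof (cases "x + y = 0")
  case False
  then have s: "x + y > 0" using assms by auto
  have *: "v powr q \<le> v / (x + y) * (x + y) powr q" if "0 \<le> v" "v \<le> x + y" for v
  proof -
    have "(v / (x + y)) powr q \<le> (v / (x + y)) powr 1"
      using that s assms by (intro powr_mono') auto
    then have "(v / (x + y)) powr q * (x + y) powr q \<le> v / (x + y) * (x + y) powr q"
      using that s by (intro mult_right_mono) auto
    then show ?thesis
      using that s by (simp add: powr_divide)
  qed
  have "x powr q + y powr q \<le> x / (x + y) * (x + y) powr q + y / (x + y) * (x + y) powr q"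
    by (intro add_mono * assms) (use assms in auto)
  also have "\<dots> = (x + y) powr q"
    using s by (simp flip: distrib_right add_divide_distrib)
  finally show ?thesis .
next
  case True
  then have "x = 0" "y = 0" using assms by linarith+
  then show ?thesis by simp
qed

text \<open>
  Extends the convexity of $x^q$ from the open half line to $0$.
\<close>
lemma powr_convex_combination:
  fixes x y s :: real
  assumes "0 \<le> x" "0 \<le> y" "0 \<le> s" "s \<le> 1" "1 \<le> q"
  shows "((1 - s) * x + s * y) powr q \<le> (1 - s) * x powr q + s * y powr q"
proof -
  have *: "(r * v) powr q \<le> r * v powr q" if "0 \<le> r" "r \<le> 1" "0 \<le> v" for r v :: real
  proof -
    have "r powr q \<le> r powr 1"
      using that assms by (intro powr_mono') auto
    then show ?thesis
      using that by (simp add: powr_mult mult_right_mono)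
  qed
  show ?thesis
  proof (cases "x = 0 \<or> y = 0")
    case True
    then show ?thesis using *[of "1 - s" x] *[of s y] assms by auto
  next
    case False
    then show ?thesis
      using convex_onD[OF powr_convex[OF \<open>1 \<le> q\<close>], of s x y] assms by simp
  qed
qed

lemma norm_powr_convex:
  fixes a b :: complex
  assumes "0 \<le> s" "s \<le> 1" "1 \<le> p"
  shows "norm ((1 - s) *\<^sub>R a + s *\<^sub>R b) powr p \<le> (1 - s) * norm a powr p + s * norm b powr p"
proof -
  have "norm ((1 - s) *\<^sub>R a + s *\<^sub>R b) \<le> (1 - s) * norm a + s * norm b"
    using norm_triangle_ineq[of "(1 - s) *\<^sub>R a" "s *\<^sub>R b"] assms by simp
  then have "norm ((1 - s) *\<^sub>R a + s *\<^sub>R b) powr p \<le> ((1 - s) * norm a + s * norm b) powr p"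
    using assms by (intro powr_mono2) auto
  also have "\<dots> \<le> (1 - s) * norm a powr p + s * norm b powr p"
    using assms by (intro powr_convex_combination) auto
  finally show ?thesis .
qed

lemma norm_powr_power2: "norm a powr p = (norm a ^ 2) powr (p / 2)" for a :: complex
proof (cases "a = 0")
  case False
  then have "(norm a ^ 2) powr (p / 2) = (norm a powr 2) powr (p / 2)" 
    by (metis powr_numeral norm_ge_zero)
  also have "\<dots> = norm a powr (2 * (p / 2))"
    by (rule powr_powr)
  finally show ?thesis by simp
qed auto

text \<open>
  The easy Clarkson inequality. The parallelogram law is the case $p = 2$. For larger $p$, apply
  the superadditivity of $x^{p/2}$ on the left of the law and its convexity on the right.
\<close>
lemma clarkson_pointwise:
  fixes a b :: complex
  assumes "2 \<le> p"
  shows "norm ((a + b) / 2) powr p + norm ((a - b) / 2) powr p \<le> (norm a powr p + norm b powr p) / 2"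
proof -
  let ?q = "p / 2"
  have par: "norm ((a + b) / 2) ^ 2 + norm ((a - b) / 2) ^ 2 = (1 - 1/2) * norm a ^ 2 + 1/2 * norm b ^ 2"
    by (simp only: cmod_power2) (simp add: power2_eq_square field_simps)
  have "norm ((a + b) / 2) powr p + norm ((a - b) / 2) powr p
      \<le> (norm ((a + b) / 2) ^ 2 + norm ((a - b) / 2) ^ 2) powr ?q"
    unfolding norm_powr_power2[of _ p] using assms by (intro powr_superadd) auto
  also have "\<dots> \<le> (1 - 1/2) * (norm a ^ 2) powr ?q + 1/2 * (norm b ^ 2) powr ?q"
    unfolding par using assms by (intro powr_convex_combination) auto
  finally show ?thesis
    unfolding norm_powr_power2[of _ p, symmetric] by argo
qed

text \<open>
  A substitute for Minkowski's inequality that needs no integration: either $|b| \le \theta |a|$ or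
  $|a| \le |b|/\theta$. Since $\theta$ can be as small as desired, it yields the continuity of
  $\int |f|^p$ in $f$.
\<close>
lemma norm_add_powr_le:
  fixes a b :: complex
  assumes "0 < \<theta>" "0 \<le> p"
  shows "norm (a + b) powr p \<le> (1 + \<theta>) powr p * norm a powr p + (1 + 1 / \<theta>) powr p * norm b powr p"
proof (cases "norm b \<le> \<theta> * norm a")
  case True
  then have "norm (a + b) powr p \<le> ((1 + \<theta>) * norm a) powr p"
    using norm_triangle_ineq[of a b] assms by (intro powr_mono2) (auto simp: distrib_right)
  then show ?thesis
    using assms by (simp add: powr_mult add_increasing2)
next
  case False
  then have "norm a \<le> norm b / \<theta>"
    using assms by (simp add: field_simps)
  then have "norm (a + b) powr p \<le> ((1 + 1 / \<theta>) * norm b) powr p"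
    using norm_triangle_ineq[of a b] assms by (intro powr_mono2) (auto simp: distrib_right)
  then show ?thesis
    using assms by (simp add: powr_mult add_increasing)
qed

text \<open>
  A substitute for Hoelder's inequality: with $b = c^{p-1}$, compare $a$ with $\theta c$. The
  weight $\theta$ makes the pairing small as soon as $\int a^p$ is.
\<close>
lemma mult_le_weighted_powr:
  fixes a b :: real
  assumes "0 \<le> a" "0 \<le> b" "0 < \<theta>" "1 < p"
  shows "a * b \<le> \<theta> * b powr (p / (p - 1)) + \<theta> powr (1 - p) * a powr p"
proof (cases "b = 0")
  case False
  define c where "c = b powr (1 / (p - 1))"
  have c: "c > 0" "b = c powr (p - 1)" "b powr (p / (p - 1)) = c powr p"
    using False assms by (auto simp: c_def powr_powr)
  have "a * c powr (p - 1) \<le> \<theta> * c powr p + \<theta> powr (1 - p) * a powr p"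
  proof (cases "a \<le> \<theta> * c")
    case True
    then have "a * c powr (p - 1) \<le> \<theta> * c * c powr (p - 1)"
      using c by (intro mult_right_mono) auto
    also have "\<dots> = \<theta> * c powr p"
      using c powr_mult_base[of c "p - 1"] by simp
    finally show ?thesis by (simp add: add_increasing2)
  next
    case False
    moreover have "\<theta> * c > 0" using c assms by simp
    ultimately have "a > 0" by linarith
    have "c powr (p - 1) \<le> (a / \<theta>) powr (p - 1)"
      using \<open>\<not> a \<le> \<theta> * c\<close> assms c by (intro powr_mono2) (auto simp: field_simps)
    then have "a * c powr (p - 1) \<le> a * (a / \<theta>) powr (p - 1)"
      using \<open>a > 0\<close> by (intro mult_left_mono) auto
    also have "\<dots> = \<theta> powr (1 - p) * a powr p"
      using \<open>a > 0\<close> assms powr_mult_base[of a "p - 1"] powr_minus_divide[of \<theta> "p - 1"]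
      by (simp add: powr_divide)
    finally show ?thesis using assms c by (simp add: add_increasing)
  qed
  then show ?thesis using c by simp
qed (use assms in auto)

lemma norm_le_weighted_powr:
  fixes a :: complex
  assumes "0 < \<theta>" "1 < p"
  shows "norm a \<le> \<theta> + \<theta> powr (1 - p) * norm a powr p"
proof -
  have "norm a * 1 \<le> \<theta> * 1 powr (p / (p - 1)) + \<theta> powr (1 - p) * norm a powr p"
    using assms by (intro mult_le_weighted_powr) auto
  then show ?thesis
    by (simp only: powr_one_eq_one mult_1_right)
qed

section \<open>The space $L^p$ of a measure\<close>

definition pint :: "'a measure \<Rightarrow> real \<Rightarrow> ('a \<Rightarrow> complex) \<Rightarrow> real" where
  "pint M p f = (LINT z|M. norm (f z) powr p)"

definition Lp_set :: "'a measure \<Rightarrow> real \<Rightarrow> ('a \<Rightarrow> complex) set" where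
  "Lp_set M p = {f \<in> borel_measurable M. integrable M (\<lambda>z. norm (f z) powr p)}"

lemma Lp_setD:
  assumes "f \<in> Lp_set M p"
  shows "f \<in> borel_measurable M" "integrable M (\<lambda>z. norm (f z) powr p)"
  using assms by (auto simp: Lp_set_def)

lemma pint_nonneg: "0 \<le> pint M p f"
  by (simp add: pint_def)

lemma Lp_set_add:
  assumes "f \<in> Lp_set M p" "g \<in> Lp_set M p" "0 \<le> p"
  shows "(\<lambda>z. f z + g z) \<in> Lp_set M p"
proof -
  note [measurable] = Lp_setD(1)[OF assms(1)] Lp_setD(1)[OF assms(2)]
  have "integrable M (\<lambda>z. norm (f z + g z) powr p)"
  proof (rule Bochner_Integration.integrable_bound)
    show "integrable M (\<lambda>z. (1 + 1) powr p * norm (f z) powr p + (1 + 1 / 1) powr p * norm (g z) powr p)"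
      by (intro Bochner_Integration.integrable_add integrable_mult_right Lp_setD(2) assms)
    show "AE z in M. norm (norm (f z + g z) powr p)
        \<le> norm ((1 + 1) powr p * norm (f z) powr p + (1 + 1 / 1) powr p * norm (g z) powr p)"
      using norm_add_powr_le[of 1 p] assms by (intro AE_I2) (simp add: abs_of_nonneg)
  qed measurable
  then show ?thesis by (simp add: Lp_set_def)
qed

lemma Lp_set_cmult:
  assumes "f \<in> Lp_set M p"
  shows "(\<lambda>z. c * f z) \<in> Lp_set M p"
  using assms by (auto simp: Lp_set_def norm_mult powr_mult)

lemma pint_cmult: "pint M p (\<lambda>z. c * f z) = norm c powr p * pint M p f"
  by (simp add: pint_def norm_mult powr_mult)

lemma Lp_set_diff:
  assumes "f \<in> Lp_set M p" "g \<in> Lp_set M p" "0 \<le> p"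
  shows "(\<lambda>z. f z - g z) \<in> Lp_set M p"
  using Lp_set_add[OF assms(1) Lp_set_cmult[OF assms(2), of "-1"]] assms(3) by simp

lemma pint_add_le:
  assumes "f \<in> Lp_set M p" "g \<in> Lp_set M p" "0 < \<theta>" "0 \<le> p"
  shows "pint M p (\<lambda>z. f z + g z) \<le> (1 + \<theta>) powr p * pint M p f + (1 + 1 / \<theta>) powr p * pint M p g"
proof -
  note [simp] = Lp_setD(2)[OF assms(1)] Lp_setD(2)[OF assms(2)] Lp_setD(2)[OF Lp_set_add[OF assms(1,2,4)]]
  have "pint M p (\<lambda>z. f z + g z)
      \<le> (LINT z|M. (1 + \<theta>) powr p * norm (f z) powr p + (1 + 1 / \<theta>) powr p * norm (g z) powr p)"
    unfolding pint_def using norm_add_powr_le assms by (intro integral_mono) auto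
  then show ?thesis by (simp add: pint_def)
qed

lemma pint_clarkson:
  assumes "f \<in> Lp_set M p" "g \<in> Lp_set M p" "2 \<le> p"
  shows "pint M p (\<lambda>z. (f z + g z) / 2) + pint M p (\<lambda>z. (f z - g z) / 2) \<le> (pint M p f + pint M p g) / 2"
proof -
  have p: "0 \<le> p" using assms by simp
  have i: "integrable M (\<lambda>z. norm ((f z + g z) / 2) powr p)" "integrable M (\<lambda>z. norm ((f z - g z) / 2) powr p)"
    using Lp_setD(2)[OF Lp_set_cmult[OF Lp_set_add[OF assms(1,2) p], of "1/2"]]
      Lp_setD(2)[OF Lp_set_cmult[OF Lp_set_diff[OF assms(1,2) p], of "1/2"]] by auto
  note [simp] = Lp_setD(2)[OF assms(1)] Lp_setD(2)[OF assms(2)]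
  have "pint M p (\<lambda>z. (f z + g z) / 2) + pint M p (\<lambda>z. (f z - g z) / 2)
     = (LINT z|M. norm ((f z + g z) / 2) powr p + norm ((f z - g z) / 2) powr p)"
    unfolding pint_def using i by (intro Bochner_Integration.integral_add[symmetric])
  also have "\<dots> \<le> (LINT z|M. (norm (f z) powr p + norm (g z) powr p) / 2)"
    using clarkson_pointwise[OF assms(3)] i by (intro integral_mono Bochner_Integration.integrable_add) auto
  finally show ?thesis by (simp add: pint_def)
qed

lemma pint_ge_limit:
  assumes "\<And>n. f n \<in> Lp_set M p" "g \<in> Lp_set M p" "0 \<le> p"
    and lim: "(\<lambda>n. pint M p (\<lambda>z. f n z - g z)) \<longlonglongrightarrow> 0"
    and ge: "\<And>n. d \<le> pint M p (f n)"
  shows "d \<le> pint M p g"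
proof -
  have *: "d \<le> (1 + \<theta>) powr p * pint M p g" if "\<theta> > 0" for \<theta>
  proof (rule LIMSEQ_le_const)
    show "(\<lambda>n. (1 + \<theta>) powr p * pint M p g + (1 + 1 / \<theta>) powr p * pint M p (\<lambda>z. f n z - g z))
        \<longlonglongrightarrow> (1 + \<theta>) powr p * pint M p g"
      using lim by (auto intro!: tendsto_eq_intros)
    show "\<exists>N. \<forall>n\<ge>N. d \<le> (1 + \<theta>) powr p * pint M p g + (1 + 1 / \<theta>) powr p * pint M p (\<lambda>z. f n z - g z)"
    proof (intro exI allI impI)
      fix n
      have "pint M p (\<lambda>z. g z + (f n z - g z)) \<le> (1 + \<theta>) powr p * pint M p g + (1 + 1 / \<theta>) powr p * pint M p (\<lambda>z. f n z - g z)"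
        using assms that by (intro pint_add_le Lp_set_diff) auto
      with ge[of n] show "d \<le> (1 + \<theta>) powr p * pint M p g + (1 + 1 / \<theta>) powr p * pint M p (\<lambda>z. f n z - g z)"
        by simp
    qed
  qed
  have "((\<lambda>\<theta>. (1 + \<theta>) powr p * pint M p g) \<longlongrightarrow> (1 + 0) powr p * pint M p g) (at_right 0)"
    by (intro tendsto_intros) auto
  then have "d \<le> (1 + 0) powr p * pint M p g"
    by (rule tendsto_lowerbound) (auto intro!: eventually_at_rightI[of 0 1] *)
  then show ?thesis by simp
qed

lemma pint_le_limit:
  assumes "\<And>n. f n \<in> Lp_set M p" "g \<in> Lp_set M p" "0 \<le> p"
    and lim: "(\<lambda>n. pint M p (\<lambda>z. f n z - g z)) \<longlonglongrightarrow> 0"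
    and lim_d: "(\<lambda>n. pint M p (f n)) \<longlonglongrightarrow> d"
  shows "pint M p g \<le> d"
proof -
  have sym: "pint M p (\<lambda>z. g z - f n z) = pint M p (\<lambda>z. f n z - g z)" for n
    by (simp add: pint_def norm_minus_commute)
  have *: "pint M p g \<le> (1 + \<theta>) powr p * d" if "\<theta> > 0" for \<theta>
  proof (rule LIMSEQ_le_const)
    show "(\<lambda>n. (1 + \<theta>) powr p * pint M p (f n) + (1 + 1 / \<theta>) powr p * pint M p (\<lambda>z. g z - f n z))
        \<longlonglongrightarrow> (1 + \<theta>) powr p * d"
      unfolding sym using lim lim_d by (auto intro!: tendsto_eq_intros)
    show "\<exists>N. \<forall>n\<ge>N. pint M p g \<le> (1 + \<theta>) powr p * pint M p (f n) + (1 + 1 / \<theta>) powr p * pint M p (\<lambda>z. g z - f n z)"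
    proof (intro exI allI impI)
      fix n
      have "pint M p (\<lambda>z. f n z + (g z - f n z)) \<le> (1 + \<theta>) powr p * pint M p (f n) + (1 + 1 / \<theta>) powr p * pint M p (\<lambda>z. g z - f n z)"
        using assms that by (intro pint_add_le Lp_set_diff) auto
      then show "pint M p g \<le> (1 + \<theta>) powr p * pint M p (f n) + (1 + 1 / \<theta>) powr p * pint M p (\<lambda>z. g z - f n z)"
        by simp
    qed
  qed
  have "((\<lambda>\<theta>. (1 + \<theta>) powr p * d) \<longlongrightarrow> (1 + 0) powr p * d) (at_right 0)"
    by (intro tendsto_intros) auto
  then have "pint M p g \<le> (1 + 0) powr p * d"
    by (rule tendsto_lowerbound) (auto intro!: eventually_at_rightI[of 0 1] *)
  then show ?thesis by simp
qed

text \<open>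
  Riesz-Fischer. On a finite measure space an $L^p$ Cauchy sequence is Cauchy in $L^1$, so a
  subsequence converges almost everywhere, and Fatou's lemma turns this limit into an $L^p$ limit.
\<close>
lemma Lp_complete:
  assumes "finite_measure M" "1 < p" and F: "\<And>n. F n \<in> Lp_set M p"
    and Cau: "\<And>e. e > 0 \<Longrightarrow> \<exists>N. \<forall>i\<ge>N. \<forall>j\<ge>N. pint M p (\<lambda>z. F i z - F j z) < e"
  obtains g where "g \<in> Lp_set M p" "(\<lambda>n. pint M p (\<lambda>z. F n z - g z)) \<longlonglongrightarrow> 0"
proof -
  interpret finite_measure M by fact
  have p: "0 \<le> p" using assms by simp
  note [measurable] = Lp_setD(1)[OF F]
  have L1: "integrable M f" "(LINT z|M. norm (f z)) \<le> \<theta> * measure M (space M) + \<theta> powr (1 - p) * pint M p f"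
    if f: "f \<in> Lp_set M p" and "\<theta> > 0" for f \<theta>
  proof -
    note [measurable] = Lp_setD(1)[OF f]
    have i: "integrable M (\<lambda>z. \<theta> + \<theta> powr (1 - p) * norm (f z) powr p)"
      using Lp_setD(2)[OF f] by simp
    show i': "integrable M f"
      by (rule Bochner_Integration.integrable_bound[OF i])
        (use norm_le_weighted_powr[OF \<open>\<theta> > 0\<close> \<open>1 < p\<close>] in \<open>auto intro!: AE_I2 intro: order_trans[OF _ abs_ge_self]\<close>)
    have "(LINT z|M. norm (f z)) \<le> (LINT z|M. \<theta> + \<theta> powr (1 - p) * norm (f z) powr p)"
      using norm_le_weighted_powr[OF \<open>\<theta> > 0\<close> \<open>1 < p\<close>] i i' by (intro integral_mono) auto
    also have "\<dots> = \<theta> * measure M (space M) + \<theta> powr (1 - p) * pint M p f"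
      using Lp_setD(2)[OF f] by (simp add: pint_def)
    finally show "(LINT z|M. norm (f z)) \<le> \<theta> * measure M (space M) + \<theta> powr (1 - p) * pint M p f" .
  qed
  obtain r where r: "strict_mono r" "AE x in M. Cauchy (\<lambda>i. F (r i) x)"
  proof (rule cauchy_L1_AE_cauchy_subseq)
    show "integrable M (F n)" for n by (rule L1(1)[OF F zero_less_one])
    fix e :: real assume "e > 0"
    define m where "m = measure M (space M)"
    define \<theta> where "\<theta> = e / (2 * (m + 1))"
    have m: "m \<ge> 0" by (simp add: m_def)
    have \<theta>: "\<theta> > 0" using \<open>e > 0\<close> m by (simp add: \<theta>_def)
    have "\<theta> * m \<le> \<theta> * (m + 1)" using \<theta> by simp
    also have "\<theta> * (m + 1) = e / 2" using m by (simp add: \<theta>_def field_simps)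
    finally have \<theta>m: "\<theta> * m \<le> e / 2" .
    have "e / 2 / \<theta> powr (1 - p) > 0" using \<theta> \<open>e > 0\<close> by simp
    from Cau[OF this] obtain N where N: "\<And>i j. i \<ge> N \<Longrightarrow> j \<ge> N \<Longrightarrow> pint M p (\<lambda>z. F i z - F j z) < e / 2 / \<theta> powr (1 - p)"
      by blast
    have "(LINT z|M. norm (F i z - F j z)) < e" if "i \<ge> N" "j \<ge> N" for i j
    proof -
      have "(LINT z|M. norm (F i z - F j z)) \<le> \<theta> * m + \<theta> powr (1 - p) * pint M p (\<lambda>z. F i z - F j z)"
        unfolding m_def by (intro L1(2) Lp_set_diff F p \<theta>)
      moreover have "\<theta> powr (1 - p) * pint M p (\<lambda>z. F i z - F j z) < e / 2"
        using N[OF that] \<theta> by (simp add: field_simps)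
      ultimately show ?thesis using \<theta>m by linarith
    qed
    then show "\<exists>N. \<forall>i\<ge>N. \<forall>j\<ge>N. (LINT x|M. norm (F i x - F j x)) < e" by blast
  qed
  define g where "g = (\<lambda>z. lim (\<lambda>i. F (r i) z))"
  have g[measurable]: "g \<in> borel_measurable M" unfolding g_def by measurable
  have lim: "AE z in M. (\<lambda>i. F (r i) z) \<longlonglongrightarrow> g z"
    using r(2) by eventually_elim (auto simp: g_def convergent_LIMSEQ_iff[symmetric] Cauchy_convergent)
  have near: "(\<lambda>z. F i z - g z) \<in> Lp_set M p \<and> pint M p (\<lambda>z. F i z - g z) \<le> e"
    if "e > 0" and N: "\<And>i j. i \<ge> N \<Longrightarrow> j \<ge> N \<Longrightarrow> pint M p (\<lambda>z. F i z - F j z) < e" and "i \<ge> N" for e N i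
  proof -
    have "(\<integral>\<^sup>+ z. ennreal (norm (F i z - g z) powr p) \<partial>M)
        = (\<integral>\<^sup>+ z. liminf (\<lambda>j. ennreal (norm (F i z - F (r j) z) powr p)) \<partial>M)"
    proof (rule nn_integral_cong_AE)
      show "AE z in M. ennreal (norm (F i z - g z) powr p) = liminf (\<lambda>j. ennreal (norm (F i z - F (r j) z) powr p))"
        using lim
      proof eventually_elim
        case (elim z)
        have "(\<lambda>j. ennreal (norm (F i z - F (r j) z) powr p)) \<longlonglongrightarrow> ennreal (norm (F i z - g z) powr p)"
          using elim assms(2) by (intro tendsto_ennrealI tendsto_powr2 tendsto_intros) auto
        then show ?case by (rule lim_imp_Liminf[OF sequentially_bot, symmetric])
      qed
    qed
    also have "\<dots> \<le> liminf (\<lambda>j. \<integral>\<^sup>+ z. ennreal (norm (F i z - F (r j) z) powr p) \<partial>M)"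
      by (intro nn_integral_liminf) measurable
    also have "\<dots> \<le> liminf (\<lambda>j. ennreal e)"
    proof (rule Liminf_mono)
      show "\<forall>\<^sub>F j in sequentially. (\<integral>\<^sup>+ z. ennreal (norm (F i z - F (r j) z) powr p) \<partial>M) \<le> ennreal e"
        using eventually_ge_at_top[of N]
      proof eventually_elim
        case (elim j)
        have "pint M p (\<lambda>z. F i z - F (r j) z) < e"
          using seq_suble[OF r(1), of j] elim that by (intro N) auto
        then show ?case
          using Lp_setD(2)[OF Lp_set_diff[OF F F p]]
          by (subst nn_integral_eq_integral) (auto simp: pint_def intro!: ennreal_leI)
      qed
    qed
    also have "\<dots> = ennreal e" by (simp add: Liminf_const)
    finally have le: "(\<integral>\<^sup>+ z. ennreal (norm (F i z - g z) powr p) \<partial>M) \<le> ennreal e" .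
    then have "integrable M (\<lambda>z. norm (F i z - g z) powr p)"
      by (intro integrableI_bounded) (auto simp: le_less_trans)
    moreover have "pint M p (\<lambda>z. F i z - g z) \<le> e"
      using calculation le \<open>e > 0\<close> unfolding pint_def
      by (subst (asm) nn_integral_eq_integral) (auto simp: ennreal_le_iff)
    ultimately show ?thesis by (simp add: Lp_set_def)
  qed
  obtain N where "\<And>i j. i \<ge> N \<Longrightarrow> j \<ge> N \<Longrightarrow> pint M p (\<lambda>z. F i z - F j z) < 1"
    using Cau[of 1] by auto
  from near[OF _ this, of N] have "(\<lambda>z. F N z - g z) \<in> Lp_set M p" by simp
  from Lp_set_diff[OF F[of N] this p] have gLp: "g \<in> Lp_set M p" by simp
  have "(\<lambda>n. pint M p (\<lambda>z. F n z - g z)) \<longlonglongrightarrow> 0"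
  proof (rule LIMSEQ_I)
    fix e :: real assume "e > 0"
    then obtain N where N: "\<And>i j. i \<ge> N \<Longrightarrow> j \<ge> N \<Longrightarrow> pint M p (\<lambda>z. F i z - F j z) < e / 2"
      using Cau[of "e / 2"] by auto
    have "norm (pint M p (\<lambda>z. F n z - g z) - 0) < e" if "n \<ge> N" for n
      using near[OF _ N that] \<open>e > 0\<close> pint_nonneg[of M p "\<lambda>z. F n z - g z"] by auto
    then show "\<exists>N. \<forall>n\<ge>N. norm (pint M p (\<lambda>z. F n z - g z) - 0) < e" by blast
  qed
  with gLp show ?thesis by (rule that)
qed

section \<open>Representation of bounded functionals on subspaces of $L^p$\<close>

text \<open>
  At $a = 0$ the derivative exists because $p > 1$; elsewhere $|a + sb|^2$ is a quadratic
  polynomial in $s$ that does not vanish at $0$.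
\<close>
lemma norm_powr_real_derivative:
  fixes a b :: complex
  assumes "2 \<le> p"
  shows "((\<lambda>s. norm (a + of_real s * b) powr p) has_real_derivative p * (norm a powr (p - 2) * Re (cnj a * b))) (at 0)"
proof (cases "a = 0")
  case True
  have "((\<lambda>s. (norm (of_real s * b) powr p - 0) / s) \<longlongrightarrow> 0) (at 0)"
  proof (rule Lim_null_comparison)
    show "\<forall>\<^sub>F s in at 0. norm ((norm (complex_of_real s * b) powr p - 0) / s) \<le> \<bar>s\<bar> powr (p - 1) * norm b powr p"
    proof (rule eventually_at_topological[THEN iffD2], intro exI[of _ UNIV] conjI ballI impI)
      fix s :: real assume "s \<noteq> 0"
      then have "\<bar>s\<bar> powr p = \<bar>s\<bar> * \<bar>s\<bar> powr (p - 1)"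
        using powr_mult_base[of "\<bar>s\<bar>" "p - 1"] by simp
      then show "norm ((norm (complex_of_real s * b) powr p - 0) / s) \<le> \<bar>s\<bar> powr (p - 1) * norm b powr p"
        using \<open>s \<noteq> 0\<close> by (simp add: norm_mult powr_mult)
    qed auto
    have "((\<lambda>s::real. \<bar>s\<bar> powr (p - 1) * norm b powr p) \<longlongrightarrow> \<bar>0\<bar> powr (p - 1) * norm b powr p) (at 0)"
      using assms by (intro tendsto_mult tendsto_powr' tendsto_intros) auto
    then show "((\<lambda>s::real. \<bar>s\<bar> powr (p - 1) * norm b powr p) \<longlongrightarrow> 0) (at 0)" by simp
  qed
  then show ?thesis
    using True assms by (simp add: has_field_derivative_iff)
next
  case False
  define R where "R = Re (cnj a * b)"
  define q where "q = (\<lambda>s. norm a ^ 2 + 2 * s * R + s ^ 2 * norm b ^ 2)"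
  have q: "norm (a + of_real s * b) ^ 2 = q s" for s
    unfolding q_def R_def by (simp only: cmod_power2) (simp add: power2_eq_square algebra_simps)
  have "((\<lambda>s. q s powr (p / 2)) has_real_derivative (p / 2) * (q 0 powr (p / 2 - 1)) * (2 * R)) (at 0)"
    unfolding q_def using False by (auto intro!: derivative_eq_intros)
  moreover have "q 0 powr (p / 2 - 1) = norm a powr (p - 2)"
    using norm_powr_power2[of a "p - 2"] by (simp add: q_def diff_divide_distrib)
  moreover have "(\<lambda>s. norm (a + of_real s * b) powr p) = (\<lambda>s. q s powr (p / 2))"
    by (subst norm_powr_power2) (simp add: q)
  ultimately show ?thesis unfolding R_def[symmetric] by (simp add: mult_ac)
qed

text \<open>
  Difference quotients of the convex function $s \mapsto |a+sb|^p$ at $0$ with $0 < s \le 1$ lie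
  between those for $s = -1$ and $s = 1$. The bounds do not depend on $s$, which allows
  differentiation under the integral sign by dominated convergence.
\<close>
lemma norm_powr_difference_quotient_bounds:
  fixes a b :: complex
  assumes "0 < s" "s \<le> 1" "1 \<le> p"
  shows "(norm (a + of_real s * b) powr p - norm a powr p) / s \<le> norm (a + b) powr p - norm a powr p"
    and "norm a powr p - norm (a - b) powr p \<le> (norm (a + of_real s * b) powr p - norm a powr p) / s"
proof -
  have "norm ((1 - s) *\<^sub>R a + s *\<^sub>R (a + b)) powr p \<le> (1 - s) * norm a powr p + s * norm (a + b) powr p"
    using assms by (intro norm_powr_convex) auto
  moreover have "(1 - s) *\<^sub>R a + s *\<^sub>R (a + b) = a + of_real s * b"
    by (simp add: scaleR_conv_of_real algebra_simps)
  ultimately show "(norm (a + of_real s * b) powr p - norm a powr p) / s \<le> norm (a + b) powr p - norm a powr p"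
    using assms by (simp add: field_simps)
next
  \<comment> \<open>The weight for which $a$ is a convex combination of $a + sb$ and $a - b$.\<close>
  define r where "r = s / (1 + s)"
  have r: "0 \<le> r" "r \<le> 1" "1 - r = 1 / (1 + s)" using assms by (auto simp: r_def field_simps)
  have "norm ((1 - r) *\<^sub>R (a + of_real s * b) + r *\<^sub>R (a - b)) powr p
      \<le> (1 - r) * norm (a + of_real s * b) powr p + r * norm (a - b) powr p"
    using r assms by (intro norm_powr_convex) auto
  moreover have "(1 - r) *\<^sub>R (a + of_real s * b) + r *\<^sub>R (a - b) = a"
  proof -
    have "(1 - r) *\<^sub>R (a + of_real s * b) + r *\<^sub>R (a - b) = a + of_real (s - r * (1 + s)) * b"
      by (simp add: scaleR_conv_of_real algebra_simps)
    also have "s - r * (1 + s) = 0" using assms by (simp add: r_def)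
    finally show ?thesis by simp
  qed
  ultimately have "norm a powr p \<le> (norm (a + of_real s * b) powr p + s * norm (a - b) powr p) / (1 + s)"
    by (simp add: r(3) add_divide_distrib) (simp add: r_def)
  then have "(1 + s) * norm a powr p \<le> norm (a + of_real s * b) powr p + s * norm (a - b) powr p"
    using assms by (simp add: pos_le_divide_eq mult.commute)
  then show "norm a powr p - norm (a - b) powr p \<le> (norm (a + of_real s * b) powr p - norm a powr p) / s"
    using assms by (simp add: field_simps)
qed

text \<open>
  The integral is the derivative at $s = 0$ of $\int |g + sF|^p / p$, up to taking real parts.
  Replacing $F$ by $-F$ and $\pm iF$ upgrades the inequality to the vanishing of the whole integral.
\<close>
lemma first_variation_nonneg:
  assumes g: "g \<in> Lp_set M p" and F: "F \<in> Lp_set M p" and p: "2 \<le> p"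
    and int: "integrable M (\<lambda>z. F z * (of_real (norm (g z) powr (p - 2)) * cnj (g z)))"
    and min: "\<And>s. pint M p g \<le> pint M p (\<lambda>z. g z + of_real s * F z)"
  shows "0 \<le> Re (LINT z|M. F z * (of_real (norm (g z) powr (p - 2)) * cnj (g z)))"
proof -
  have p0: "0 \<le> p" using p by simp
  define D where "D = (\<lambda>n z. (norm (g z + of_real (1 / real (Suc n)) * F z) powr p - norm (g z) powr p) / (1 / real (Suc n)))"
  define D' where "D' = (\<lambda>z. p * (norm (g z) powr (p - 2) * Re (cnj (g z) * F z)))"
  note [measurable] = Lp_setD(1)[OF g] Lp_setD(1)[OF F]
  have [measurable]: "(\<lambda>z. cnj (g z)) \<in> borel_measurable M"
    by (intro measurable_compose[OF Lp_setD(1)[OF g]] borel_measurable_continuous_onI continuous_intros)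
  have gF: "(\<lambda>z. g z + of_real s * F z) \<in> Lp_set M p" for s
    by (intro Lp_set_add Lp_set_cmult g F p0)
  have "(\<lambda>n. LINT z|M. D n z) \<longlonglongrightarrow> (LINT z|M. D' z)"
  proof (rule integral_dominated_convergence)
    show "D' \<in> borel_measurable M" "D n \<in> borel_measurable M" for n
      unfolding D_def D'_def by measurable
    show "integrable M (\<lambda>z. (norm (g z + F z) powr p + norm (g z - F z) powr p) + norm (g z) powr p)"
      using Lp_setD(2)[OF Lp_set_add[OF g F p0]] Lp_setD(2)[OF Lp_set_diff[OF g F p0]] Lp_setD(2)[OF g]
      by (intro Bochner_Integration.integrable_add)
    show "AE z in M. (\<lambda>n. D n z) \<longlonglongrightarrow> D' z"
    proof (rule AE_I2)
      fix z
      have "((\<lambda>s. (norm (g z + of_real s * F z) powr p - norm (g z) powr p) / s) \<longlongrightarrow> D' z) (at 0)"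
        using norm_powr_real_derivative[OF p, of "g z" "F z"] by (simp add: has_field_derivative_iff D'_def)
      moreover have "filterlim (\<lambda>n. 1 / real (Suc n)) (at 0) sequentially"
        unfolding filterlim_at using LIMSEQ_inverse_real_of_nat by (auto simp: inverse_eq_divide)
      ultimately show "(\<lambda>n. D n z) \<longlonglongrightarrow> D' z"
        unfolding D_def by (rule filterlim_compose)
    qed
    fix n
    show "AE z in M. norm (D n z) \<le> (norm (g z + F z) powr p + norm (g z - F z) powr p) + norm (g z) powr p"
    proof (rule AE_I2)
      fix z
      have "D n z \<le> norm (g z + F z) powr p - norm (g z) powr p"
        "norm (g z) powr p - norm (g z - F z) powr p \<le> D n z"
        unfolding D_def using p by (intro norm_powr_difference_quotient_bounds; simp)+
      moreover have "0 \<le> norm (g z + F z) powr p" "0 \<le> norm (g z - F z) powr p" "0 \<le> norm (g z) powr p" by auto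
      ultimately show "norm (D n z) \<le> (norm (g z + F z) powr p + norm (g z - F z) powr p) + norm (g z) powr p"
        unfolding real_norm_def by linarith
    qed
  qed
  moreover have "0 \<le> (LINT z|M. D n z)" for n
  proof -
    have "(LINT z|M. D n z) = (pint M p (\<lambda>z. g z + of_real (1 / real (Suc n)) * F z) - pint M p g) / (1 / real (Suc n))"
      unfolding D_def pint_def using Lp_setD(2)[OF gF[of "1 / real (Suc n)"]] Lp_setD(2)[OF g]
      by (subst integral_divide_zero, subst Bochner_Integration.integral_diff) auto
    then show ?thesis using min[of "1 / real (Suc n)"] by simp
  qed
  ultimately have "0 \<le> (LINT z|M. D' z)"
    by (intro LIMSEQ_le_const) auto
  also have "(LINT z|M. D' z) = p * (LINT z|M. Re (F z * (of_real (norm (g z) powr (p - 2)) * cnj (g z))))"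
    unfolding D'_def by (subst integral_mult_right_zero[symmetric]) (auto intro!: Bochner_Integration.integral_cong simp: algebra_simps)
  also have "\<dots> = p * Re (LINT z|M. F z * (of_real (norm (g z) powr (p - 2)) * cnj (g z)))"
    by (simp only: integral_Re[OF int])
  finally show ?thesis using p by (simp add: zero_le_mult_iff)
qed

lemma integrable_pairing:
  fixes M :: "'a measure"
  assumes f: "f \<in> Lp_set M p" and k: "(k :: 'a \<Rightarrow> complex) \<in> borel_measurable M" "integrable M (\<lambda>z. norm (k z) powr (p / (p - 1)))"
    and "1 < p"
  shows "integrable M (\<lambda>z. f z * k z)"
    and "\<theta> > 0 \<Longrightarrow> (LINT z|M. norm (f z) * norm (k z))
      \<le> \<theta> * (LINT z|M. norm (k z) powr (p / (p - 1))) + \<theta> powr (1 - p) * pint M p f"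
proof -
  note [measurable] = Lp_setD(1)[OF f] k(1)
  have i: "integrable M (\<lambda>z. \<theta> * norm (k z) powr (p / (p - 1)) + \<theta> powr (1 - p) * norm (f z) powr p)" for \<theta>
    using Lp_setD(2)[OF f] k(2) by simp
  have le: "norm (f z) * norm (k z) \<le> \<theta> * norm (k z) powr (p / (p - 1)) + \<theta> powr (1 - p) * norm (f z) powr p"
    if "\<theta> > 0" for \<theta> z using that assms by (intro mult_le_weighted_powr) auto
  show int: "integrable M (\<lambda>z. f z * k z)"
    by (rule Bochner_Integration.integrable_bound[OF i[of 1]])
      (use le[of 1] in \<open>auto intro!: AE_I2 simp: norm_mult intro: order_trans[OF _ abs_ge_self]\<close>)
  assume "\<theta> > 0"
  have "(LINT z|M. norm (f z) * norm (k z)) \<le> (LINT z|M. \<theta> * norm (k z) powr (p / (p - 1)) + \<theta> powr (1 - p) * norm (f z) powr p)"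
    using i le[OF \<open>\<theta> > 0\<close>] integrable_norm[OF int] by (intro integral_mono) (auto simp: norm_mult)
  then show "(LINT z|M. norm (f z) * norm (k z))
      \<le> \<theta> * (LINT z|M. norm (k z) powr (p / (p - 1))) + \<theta> powr (1 - p) * pint M p f"
    using Lp_setD(2)[OF f] k(2) by (simp add: pint_def)
qed

lemma pairing_tendsto_zero:
  fixes M :: "'a measure"
  assumes f: "\<And>n. f n \<in> Lp_set M p" and k: "(k :: 'a \<Rightarrow> complex) \<in> borel_measurable M" "integrable M (\<lambda>z. norm (k z) powr (p / (p - 1)))"
    and "1 < p" and lim: "(\<lambda>n. pint M p (f n)) \<longlonglongrightarrow> 0"
  shows "(\<lambda>n. LINT z|M. norm (f n z) * norm (k z)) \<longlonglongrightarrow> 0"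
proof (rule LIMSEQ_I)
  fix e :: real assume e: "e > 0"
  define A where "A = (LINT z|M. norm (k z) powr (p / (p - 1)))"
  have A: "A \<ge> 0" by (simp add: A_def)
  define \<theta> where "\<theta> = e / (2 * (A + 1))"
  have \<theta>: "\<theta> > 0" using e A by (simp add: \<theta>_def)
  have "\<theta> * A \<le> \<theta> * (A + 1)" using \<theta> by simp
  also have "\<theta> * (A + 1) = e / 2" using A by (simp add: \<theta>_def field_simps)
  finally have \<theta>A: "\<theta> * A \<le> e / 2" .
  have "e / 2 / \<theta> powr (1 - p) > 0" using e \<theta> by simp
  then have "\<forall>\<^sub>F n in sequentially. pint M p (f n) < e / 2 / \<theta> powr (1 - p)"
    using lim by (rule order_tendstoD(2)[rotated])
  then obtain N where N: "\<And>n. n \<ge> N \<Longrightarrow> pint M p (f n) < e / 2 / \<theta> powr (1 - p)"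
    by (auto simp: eventually_sequentially)
  have "norm ((LINT z|M. norm (f n z) * norm (k z)) - 0) < e" if "n \<ge> N" for n
  proof -
    have "(LINT z|M. norm (f n z) * norm (k z)) \<le> \<theta> * A + \<theta> powr (1 - p) * pint M p (f n)"
      unfolding A_def by (rule integrable_pairing(2)[OF f k \<open>1 < p\<close> \<theta>])
    moreover have "\<theta> powr (1 - p) * pint M p (f n) < e / 2"
      using N[OF that] \<theta> by (simp add: field_simps)
    ultimately have "(LINT z|M. norm (f n z) * norm (k z)) < e" using \<theta>A by linarith
    then show ?thesis by (simp add: abs_of_nonneg)
  qed
  then show "\<exists>N. \<forall>n\<ge>N. norm ((LINT z|M. norm (f n z) * norm (k z)) - 0) < e" by blast
qed

lemma pairing_tendsto:
  fixes M :: "'a measure"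
  assumes f: "\<And>n. f n \<in> Lp_set M p" and g: "g \<in> Lp_set M p"
    and k: "(k :: 'a \<Rightarrow> complex) \<in> borel_measurable M" "integrable M (\<lambda>z. norm (k z) powr (p / (p - 1)))"
    and "1 < p" and lim: "(\<lambda>n. pint M p (\<lambda>z. f n z - g z)) \<longlonglongrightarrow> 0"
  shows "(\<lambda>n. LINT z|M. f n z * k z) \<longlonglongrightarrow> (LINT z|M. g z * k z)"
proof -
  have d: "(\<lambda>z. f n z - g z) \<in> Lp_set M p" for n
    using \<open>1 < p\<close> by (intro Lp_set_diff f g) auto
  have "(\<lambda>n. (LINT z|M. f n z * k z) - (LINT z|M. g z * k z)) \<longlonglongrightarrow> 0"
  proof (rule Lim_null_comparison)
    show "(\<lambda>n. LINT z|M. norm (f n z - g z) * norm (k z)) \<longlonglongrightarrow> 0"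
      by (rule pairing_tendsto_zero[OF d k \<open>1 < p\<close> lim])
    show "\<forall>\<^sub>F n in sequentially. norm ((LINT z|M. f n z * k z) - (LINT z|M. g z * k z)) \<le> (LINT z|M. norm (f n z - g z) * norm (k z))"
    proof (rule always_eventually, rule allI)
      fix n
      have "(LINT z|M. f n z * k z) - (LINT z|M. g z * k z) = (LINT z|M. (f n z - g z) * k z)"
        using integrable_pairing(1)[OF f k \<open>1 < p\<close>] integrable_pairing(1)[OF g k \<open>1 < p\<close>]
        by (simp add: left_diff_distrib)
      then show "norm ((LINT z|M. f n z * k z) - (LINT z|M. g z * k z)) \<le> (LINT z|M. norm (f n z - g z) * norm (k z))"
        using integral_norm_bound[of M "\<lambda>z. (f n z - g z) * k z"] by (simp add: norm_mult)
    qed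
  qed
  then show ?thesis by (rule LIM_zero_cancel)
qed

text \<open>
  The Hahn-Banach theorem and the duality of $L^p$ and $L^q$ in one step, for $p \ge 2$ and a finite
  measure. For $\Lambda \neq 0$, if $g$ is the element of smallest norm in the closure of $\{F \in V : \Lambda F = 1\}$
  and $d = \int |g|^p$, then $|g|^{p-2} \overline g / d$ represents $\Lambda$: it annihilates the
  kernel of $\Lambda$ by minimality, and it pairs to $1$ with $g$.
\<close>
theorem Lp_subspace_functional_representation:
  fixes M :: "'a measure" and \<Lambda> :: "('a \<Rightarrow> complex) \<Rightarrow> complex"
  assumes "finite_measure M" and p: "2 \<le> p"
    and V_Lp: "V \<subseteq> Lp_set M p"
    and V_lin: "\<And>F G c. F \<in> V \<Longrightarrow> G \<in> V \<Longrightarrow> (\<lambda>z. F z + c * G z) \<in> V"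
    and \<Lambda>_lin: "\<And>F G c. F \<in> V \<Longrightarrow> G \<in> V \<Longrightarrow> \<Lambda> (\<lambda>z. F z + c * G z) = \<Lambda> F + c * \<Lambda> G"
    and \<Lambda>_bound: "\<And>F. F \<in> V \<Longrightarrow> norm (\<Lambda> F) \<le> C * pint M p F powr (1 / p)"
  obtains k :: "'a \<Rightarrow> complex"
  where "k \<in> borel_measurable M" "integrable M (\<lambda>z. norm (k z) powr (p / (p - 1)))"
    "\<And>F. F \<in> V \<Longrightarrow> (LINT z|M. F z * k z) = \<Lambda> F"
proof (cases "\<exists>F\<in>V. \<Lambda> F \<noteq> 0")
  case False
  then show ?thesis using that[of "\<lambda>_. 0"] p by simp
next
  case True
  then obtain F0 where F0: "F0 \<in> V" "\<Lambda> F0 \<noteq> 0" by blast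
  have p0: "0 \<le> p" "1 < p" using p by auto
  have V: "F \<in> Lp_set M p" if "F \<in> V" for F using that V_Lp by blast
  have zero: "(\<lambda>_. 0) \<in> V" "\<Lambda> (\<lambda>_. 0) = 0"
    using V_lin[OF F0(1) F0(1), of "-1"] \<Lambda>_lin[OF F0(1) F0(1), of "-1"] by simp_all
  have cm: "(\<lambda>z. c * F z) \<in> V" "\<Lambda> (\<lambda>z. c * F z) = c * \<Lambda> F" if "F \<in> V" for F c
    using V_lin[OF zero(1) that] \<Lambda>_lin[OF zero(1) that] zero(2) by simp_all
  define S where "S = {F \<in> V. \<Lambda> F = 1}"
  define d where "d = (INF F\<in>S. pint M p F)"
  have S_ne: "S \<noteq> {}" using cm[OF F0(1), of "1 / \<Lambda> F0"] F0(2) by (auto simp: S_def)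
  have bdd: "bdd_below (pint M p ` S)" using pint_nonneg by (auto intro!: bdd_belowI)
  have d_le: "d \<le> pint M p F" if "F \<in> S" for F
    unfolding d_def using that bdd by (intro cINF_lower) auto
  have "C > 0"
  proof -
    obtain F where "F \<in> S" using S_ne by blast
    then have "1 \<le> C * pint M p F powr (1 / p)" using \<Lambda>_bound[of F] by (auto simp: S_def)
    then have "0 < C * pint M p F powr (1 / p)" by linarith
    then show ?thesis by (simp add: zero_less_mult_iff)
  qed
  \<comment> \<open>Boundedness of the functional keeps the infimum away from $0$.\<close>
  have "(1 / C) powr p \<le> d"
    unfolding d_def
  proof (rule cINF_greatest[OF S_ne])
    fix F assume "F \<in> S"
    then have "1 \<le> C * pint M p F powr (1 / p)" using \<Lambda>_bound[of F] by (auto simp: S_def)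
    then have "1 / C \<le> pint M p F powr (1 / p)" using \<open>C > 0\<close> by (simp add: field_simps)
    then have "(1 / C) powr p \<le> (pint M p F powr (1 / p)) powr p" using \<open>C > 0\<close> p by (intro powr_mono2) auto
    then show "(1 / C) powr p \<le> pint M p F" using p pint_nonneg[of M p F] by (simp add: powr_powr)
  qed
  moreover have "0 < (1 / C) powr p" using \<open>C > 0\<close> by simp
  ultimately have d: "d > 0" by linarith
  have "\<exists>F\<in>S. pint M p F < d + 1 / real (Suc n)" for n
  proof -
    have "d < d + 1 / real (Suc n)" by simp
    then show ?thesis unfolding d_def using cINF_less_iff[OF S_ne bdd] by blast
  qed
  then obtain G where G: "\<And>n. G n \<in> S" "\<And>n. pint M p (G n) < d + 1 / real (Suc n)" by metis
  have GV: "G n \<in> V" "\<Lambda> (G n) = 1" "G n \<in> Lp_set M p" for n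
    using G(1)[of n] V by (auto simp: S_def)
  have lim_d: "(\<lambda>n. pint M p (G n)) \<longlonglongrightarrow> d"
  proof (rule tendsto_sandwich)
    show "\<forall>\<^sub>F n in sequentially. d \<le> pint M p (G n)" by (simp add: d_le G(1))
    show "\<forall>\<^sub>F n in sequentially. pint M p (G n) \<le> d + 1 / real (Suc n)" by (intro always_eventually allI less_imp_le G(2))
    show "(\<lambda>n. d + 1 / real (Suc n)) \<longlonglongrightarrow> d"
      using tendsto_add[OF tendsto_const LIMSEQ_inverse_real_of_nat, of d] by (simp add: inverse_eq_divide)
  qed auto
  \<comment> \<open>Midpoints of a minimising sequence are competitors, so Clarkson's inequality bounds the
    differences.\<close>
  have "\<exists>N. \<forall>i\<ge>N. \<forall>j\<ge>N. pint M p (\<lambda>z. G i z - G j z) < e" if "e > 0" for e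
  proof -
    define \<epsilon> where "\<epsilon> = e / 2 powr p"
    have "\<epsilon> > 0" using that by (simp add: \<epsilon>_def)
    then have "\<forall>\<^sub>F n in sequentially. pint M p (G n) < d + \<epsilon>" using lim_d by (intro order_tendstoD(2)) auto
    then obtain N where N: "\<And>n. n \<ge> N \<Longrightarrow> pint M p (G n) < d + \<epsilon>" by (auto simp: eventually_sequentially)
    have "pint M p (\<lambda>z. G i z - G j z) < e" if "i \<ge> N" "j \<ge> N" for i j
    proof -
      have "(\<lambda>z. (1/2) * (G i z + 1 * G j z)) \<in> S"
        unfolding S_def using cm[OF V_lin[OF GV(1)[of i] GV(1)[of j], of 1], of "1/2"] \<Lambda>_lin[OF GV(1)[of i] GV(1)[of j], of 1] GV(2)
        by simp
      from d_le[OF this] have "d \<le> pint M p (\<lambda>z. (G i z + G j z) / 2)" by simp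
      moreover have "pint M p (\<lambda>z. (G i z + G j z) / 2) + pint M p (\<lambda>z. (G i z - G j z) / 2) \<le> (pint M p (G i) + pint M p (G j)) / 2"
        by (rule pint_clarkson[OF GV(3) GV(3) p])
      moreover have "b < \<epsilon>" if "d \<le> a" "a + b \<le> (x + y) / 2" "x < d + \<epsilon>" "y < d + \<epsilon>" for a b x y
        using that by argo
      ultimately have "pint M p (\<lambda>z. (G i z - G j z) / 2) < \<epsilon>" using N[OF that(1)] N[OF that(2)] by blast
      moreover have "pint M p (\<lambda>z. G i z - G j z) = 2 powr p * pint M p (\<lambda>z. (G i z - G j z) / 2)"
        using pint_cmult[of M p "1/2" "\<lambda>z. G i z - G j z"] by (simp add: norm_divide powr_divide)
      ultimately show ?thesis by (simp add: \<epsilon>_def field_simps)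
    qed
    then show ?thesis by blast
  qed
  from Lp_complete[OF assms(1) p0(2) GV(3) this] obtain g where
    g: "g \<in> Lp_set M p" "(\<lambda>n. pint M p (\<lambda>z. G n z - g z)) \<longlonglongrightarrow> 0" by blast
  have gd: "pint M p g = d"
    using pint_le_limit[OF GV(3) g(1) p0(1) g(2) lim_d] pint_ge_limit[OF GV(3) g(1) p0(1) g(2), of d] d_le[OF G(1)] by force
  define k0 where "k0 = (\<lambda>z. of_real (norm (g z) powr (p - 2)) * cnj (g z))"
  note [measurable] = Lp_setD(1)[OF g(1)]
  have [measurable]: "(\<lambda>z. cnj (g z)) \<in> borel_measurable M"
    by (intro measurable_compose[OF Lp_setD(1)[OF g(1)]] borel_measurable_continuous_onI continuous_intros)
  have k0[measurable]: "k0 \<in> borel_measurable M" unfolding k0_def by measurable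
  have norm_k0: "norm (k0 z) = norm (g z) powr (p - 1)" for z
    using powr_mult_base[of "norm (g z)" "p - 2"] by (simp add: k0_def norm_mult mult.commute)
  have k0_q: "integrable M (\<lambda>z. norm (k0 z) powr (p / (p - 1)))"
    using Lp_setD(2)[OF g(1)] p by (simp add: norm_k0 powr_powr)
  have kernel_Re: "0 \<le> Re (LINT z|M. F z * k0 z)" if F: "F \<in> V" "\<Lambda> F = 0" for F
    unfolding k0_def
  proof (rule first_variation_nonneg[OF g(1) V[OF F(1)] p])
    show "integrable M (\<lambda>z. F z * (of_real (norm (g z) powr (p - 2)) * cnj (g z)))"
      using integrable_pairing(1)[OF V[OF F(1)] k0 k0_q p0(2)] by (simp add: k0_def)
    fix s :: real
    have sF: "(\<lambda>z. of_real s * F z) \<in> Lp_set M p" by (intro Lp_set_cmult V F)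
    have "d \<le> pint M p (\<lambda>z. g z + of_real s * F z)"
    proof (rule pint_ge_limit)
      show "(\<lambda>z. G n z + of_real s * F z) \<in> Lp_set M p" for n by (intro Lp_set_add GV sF p0)
      show "(\<lambda>z. g z + of_real s * F z) \<in> Lp_set M p" by (intro Lp_set_add g sF p0)
      show "(\<lambda>n. pint M p (\<lambda>z. G n z + of_real s * F z - (g z + of_real s * F z))) \<longlonglongrightarrow> 0"
        using g(2) by simp
      show "d \<le> pint M p (\<lambda>z. G n z + of_real s * F z)" for n
        using V_lin[OF GV(1)[of n] F(1), of "of_real s"] \<Lambda>_lin[OF GV(1)[of n] F(1), of "of_real s"] GV(2) F(2)
        by (intro d_le) (simp add: S_def)
    qed (rule p0)
    then show "pint M p g \<le> pint M p (\<lambda>z. g z + of_real s * F z)" by (simp add: gd)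
  qed
  have kernel: "(LINT z|M. F z * k0 z) = 0" if F: "F \<in> V" "\<Lambda> F = 0" for F
  proof -
    have *: "0 \<le> Re (c * (LINT z|M. F z * k0 z))" for c
      using kernel_Re[of "\<lambda>z. c * F z"] cm[OF F(1), of c] F(2) by (simp add: mult.assoc)
    show ?thesis using *[of 1] *[of "-1"] *[of \<i>] *[of "-\<i>"] by (simp add: complex_eq_iff)
  qed
  have rep: "(LINT z|M. F z * k0 z) = \<Lambda> F * d" if F: "F \<in> V" for F
  proof (rule LIMSEQ_unique)
    have "(\<lambda>n. LINT z|M. G n z * k0 z) \<longlonglongrightarrow> (LINT z|M. g z * k0 z)"
      by (rule pairing_tendsto[OF GV(3) g(1) k0 k0_q p0(2) g(2)])
    also have "(LINT z|M. g z * k0 z) = (LINT z|M. of_real (norm (g z) powr p))"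
    proof (rule Bochner_Integration.integral_cong[OF refl])
      fix z
      have "g z * k0 z = of_real (norm (g z) powr (p - 2) * norm (g z) ^ 2)"
        using complex_norm_square[of "g z"] by (simp add: k0_def mult_ac)
      also have "norm (g z) powr (p - 2) * norm (g z) ^ 2 = norm (g z) powr p"
        by (cases "g z = 0") (simp_all flip: powr_numeral powr_add)
      finally show "g z * k0 z = of_real (norm (g z) powr p)" .
    qed
    also have "\<dots> = d" using gd by (simp add: pint_def)
    finally show "(\<lambda>n. \<Lambda> F * (LINT z|M. G n z * k0 z)) \<longlonglongrightarrow> \<Lambda> F * d"
      by (intro tendsto_intros)
    have "\<Lambda> F * (LINT z|M. G n z * k0 z) = (LINT z|M. F z * k0 z)" for n
    proof -
      have "(LINT z|M. (F z + (- \<Lambda> F) * G n z) * k0 z) = 0"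
        using V_lin[OF F GV(1)[of n], of "- \<Lambda> F"] \<Lambda>_lin[OF F GV(1)[of n], of "- \<Lambda> F"] GV(2)
        by (intro kernel) simp_all
      moreover have "(LINT z|M. (F z + (- \<Lambda> F) * G n z) * k0 z) = (LINT z|M. F z * k0 z) - \<Lambda> F * (LINT z|M. G n z * k0 z)"
        using integrable_pairing(1)[OF V[OF F] k0 k0_q p0(2)] integrable_pairing(1)[OF GV(3)[of n] k0 k0_q p0(2)]
        by (simp add: left_diff_distrib mult.assoc)
      ultimately show ?thesis by simp
    qed
    then show "(\<lambda>n. \<Lambda> F * (LINT z|M. G n z * k0 z)) \<longlonglongrightarrow> (LINT z|M. F z * k0 z)" by simp
  qed
  show ?thesis
  proof (rule that[of "\<lambda>z. k0 z / of_real d"])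
    show "(\<lambda>z. k0 z / of_real d) \<in> borel_measurable M" by measurable
    show "integrable M (\<lambda>z. norm (k0 z / of_real d) powr (p / (p - 1)))"
      using k0_q d by (simp add: norm_divide powr_divide)
    show "(LINT z|M. F z * (k0 z / of_real d)) = \<Lambda> F" if "F \<in> V" for F
      using rep[OF that] d by simp
  qed
qed

section \<open>Rational functions and the representing kernel\<close>

text \<open>
  The pointwise sum of two members of \<open>rational_off X\<close> may leave that set, because a quotient has
  the value $0$ at the poles. Prescribing the values only where the denominator is nonzero gives a
  linear space with the same restrictions to neighbourhoods of $X$.
\<close>
definition rational_near :: "complex set \<Rightarrow> (complex \<Rightarrow> complex) set" where
  "rational_near X = {f. \<exists>P Q. (\<forall>z\<in>X. poly Q z \<noteq> 0) \<and> (\<forall>z. poly Q z \<noteq> 0 \<longrightarrow> f z = poly P z / poly Q z)}"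

lemma rational_nearI:
  assumes "\<And>z. z \<in> X \<Longrightarrow> poly Q z \<noteq> 0" "\<And>z. poly Q z \<noteq> 0 \<Longrightarrow> f z = poly P z / poly Q z"
  shows "f \<in> rational_near X"
  using assms unfolding rational_near_def by blast

lemma rational_off_subset: "rational_off X \<subseteq> rational_near X"
  unfolding rational_off_def rational_near_def by auto

lemma rational_near_const: "(\<lambda>_. c) \<in> rational_near X"
  by (rule rational_nearI[of _ 1 _ "[:c:]"]) auto

lemma rational_near_power: "(\<lambda>z. (z - x) ^ n) \<in> rational_near X"
  by (rule rational_nearI[of _ 1 _ "[:- x, 1:] ^ n"]) (auto simp: poly_power)

lemma rational_near_inverse: "y \<notin> X \<Longrightarrow> (\<lambda>z. 1 / (z - y)) \<in> rational_near X"
  by (rule rational_nearI[of _ "[:- y, 1:]" _ 1]) auto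

lemma rational_near_lin:
  assumes "F \<in> rational_near X" "G \<in> rational_near X"
  shows "(\<lambda>z. F z + c * G z) \<in> rational_near X"
proof -
  obtain P Q P' Q' where "\<forall>z\<in>X. poly Q z \<noteq> 0" "\<forall>z\<in>X. poly Q' z \<noteq> 0"
    "\<forall>z. poly Q z \<noteq> 0 \<longrightarrow> F z = poly P z / poly Q z"
    "\<forall>z. poly Q' z \<noteq> 0 \<longrightarrow> G z = poly P' z / poly Q' z"
    using assms unfolding rational_near_def by auto
  then show ?thesis
    by (intro rational_nearI[of _ "Q * Q'" _ "P * Q' + smult c (P' * Q)"]) (auto simp: field_simps)
qed

lemma rational_near_mult:
  assumes "F \<in> rational_near X" "G \<in> rational_near X"
  shows "(\<lambda>z. F z * G z) \<in> rational_near X"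
proof -
  obtain P Q P' Q' where "\<forall>z\<in>X. poly Q z \<noteq> 0" "\<forall>z\<in>X. poly Q' z \<noteq> 0"
    "\<forall>z. poly Q z \<noteq> 0 \<longrightarrow> F z = poly P z / poly Q z"
    "\<forall>z. poly Q' z \<noteq> 0 \<longrightarrow> G z = poly P' z / poly Q' z"
    using assms unfolding rational_near_def by auto
  then show ?thesis
    by (intro rational_nearI[of _ "Q * Q'" _ "P * P'"]) auto
qed

lemma rational_near_divided_difference:
  assumes "F \<in> rational_near X" "y \<in> X"
  obtains G where "G \<in> rational_near X" "\<And>z. z \<in> X \<Longrightarrow> (z - y) * G z = F z - F y"
proof -
  obtain P Q where PQ: "\<forall>z\<in>X. poly Q z \<noteq> 0" "\<forall>z. poly Q z \<noteq> 0 \<longrightarrow> F z = poly P z / poly Q z"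
    using assms unfolding rational_near_def by auto
  have "poly (smult (poly Q y) P - smult (poly P y) Q) y = 0" by simp
  then obtain R where R: "smult (poly Q y) P - smult (poly P y) Q = [:- y, 1:] * R"
    unfolding poly_eq_0_iff_dvd by blast
  show ?thesis
  proof (rule that[of "\<lambda>z. poly R z / poly (smult (poly Q y) Q) z"])
    show "(\<lambda>z. poly R z / poly (smult (poly Q y) Q) z) \<in> rational_near X"
      using PQ(1) assms(2) by (intro rational_nearI[of _ "smult (poly Q y) Q" _ R]) auto
    fix z assume z: "z \<in> X"
    have "poly Q y * poly P z - poly P y * poly Q z = (z - y) * poly R z"
      using arg_cong[OF R, of "\<lambda>p. poly p z"] by (simp add: algebra_simps)
    then have "(z - y) * (poly R z / (poly Q y * poly Q z)) = poly P z / poly Q z - poly P y / poly Q y"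
      using PQ(1) z assms(2) by (simp add: field_simps)
    then show "(z - y) * (poly R z / poly (smult (poly Q y) Q) z) = F z - F y"
      using PQ z assms(2) by simp
  qed
qed

lemma rational_near_analytic:
  assumes "F \<in> rational_near X" "x \<in> X"
  shows "F analytic_on {x}"
proof -
  obtain P Q where PQ: "\<forall>z\<in>X. poly Q z \<noteq> 0" "\<forall>z. poly Q z \<noteq> 0 \<longrightarrow> F z = poly P z / poly Q z"
    using assms unfolding rational_near_def by auto
  have "open {z. poly Q z \<noteq> 0}" by (intro open_Collect_neq continuous_intros)
  moreover have "F holomorphic_on {z. poly Q z \<noteq> 0}"
    by (rule holomorphic_transform[of "\<lambda>z. poly P z / poly Q z"]) (use PQ in \<open>auto intro!: holomorphic_intros\<close>)
  ultimately show ?thesis using PQ(1) assms(2) by (auto simp: analytic_at)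
qed

lemma rational_near_continuous: "F \<in> rational_near X \<Longrightarrow> continuous_on X F"
  using rational_near_analytic analytic_on_analytic_at analytic_imp_holomorphic holomorphic_on_imp_continuous_on
  by blast

lemma rational_near_bounded:
  assumes "compact X" "F \<in> rational_near X"
  obtains B where "\<And>z. z \<in> X \<Longrightarrow> norm (F z) \<le> B"
  using compact_imp_bounded[OF compact_continuous_image[OF rational_near_continuous[OF assms(2)] assms(1)]]
  by (auto simp: bounded_iff)

lemma finite_measure_lebesgue_on_compact: "compact X \<Longrightarrow> finite_measure (lebesgue_on X)" for X :: "complex set"
  by (intro finite_measure_lebesgue_on lmeasurable_compact)

lemma rational_near_measurable:
  assumes "compact X" "F \<in> rational_near X"
  shows "F \<in> borel_measurable (lebesgue_on X)"
  using assms by (intro continuous_imp_measurable_on_sets_lebesgue rational_near_continuous)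
    (auto intro: fmeasurableD lmeasurable_compact)

lemma rational_near_Lp:
  assumes "compact X" "F \<in> rational_near X" "0 \<le> p"
  shows "F \<in> Lp_set (lebesgue_on X) p"
proof -
  interpret finite_measure "lebesgue_on X" using assms(1) by (rule finite_measure_lebesgue_on_compact)
  note [measurable] = rational_near_measurable[OF assms(1,2)]
  obtain B where B: "\<And>z. z \<in> X \<Longrightarrow> norm (F z) \<le> B" using rational_near_bounded assms by blast
  have "integrable (lebesgue_on X) (\<lambda>z. norm (F z) powr p)"
    by (rule integrable_const_bound[of _ "B powr p"]) (auto intro!: AE_I2 powr_mono2 B assms)
  then show ?thesis by (simp add: Lp_set_def)
qed

text \<open>
  Only the term of Leibniz' formula in which $(z-x)^n$ is differentiated $n$ times survives.
\<close>
lemma higher_deriv_power_mult: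
  assumes "F analytic_on {x}"
  shows "(deriv ^^ t) (\<lambda>z. (z - x) ^ n * F z) x
    = (if n \<le> t then of_nat (t choose n) * fact n * (deriv ^^ (t - n)) F x else 0)"
proof -
  have pw: "(deriv ^^ i) (\<lambda>z. (z - x) ^ n) x = (if i = n then fact n else 0)" for i
  proof -
    consider "i < n" | "i = n" | "n < i" by linarith
    then show ?thesis
      by cases (simp_all add: higher_deriv_power pochhammer_0_left pochhammer_fact[symmetric])
  qed
  have "(deriv ^^ t) (\<lambda>z. (z - x) ^ n * F z) x
      = (\<Sum>i = 0..t. of_nat (t choose i) * (deriv ^^ i) (\<lambda>z. (z - x) ^ n) x * (deriv ^^ (t - i)) F x)"
    by (intro higher_deriv_mult_at assms analytic_intros)
  also have "\<dots> = (\<Sum>i = 0..t. if i = n then of_nat (t choose n) * fact n * (deriv ^^ (t - n)) F x else 0)"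
    by (intro sum.cong refl) (auto simp: pw)
  finally show ?thesis by (simp add: sum.delta)
qed

text \<open>
  Members of \<open>rational_near X\<close> agree with members of \<open>rational_off X\<close> on $X$ and near $x_0$, so
  the bound of the point derivation carries over and the representation theorem applies.
\<close>
lemma bounded_point_derivation_representation:
  assumes "compact X" "x0 \<in> X" "2 \<le> p" "has_bounded_point_derivation X p t x0"
  obtains K :: "complex \<Rightarrow> complex"
  where "K \<in> borel_measurable (lebesgue_on X)" "integrable (lebesgue_on X) (\<lambda>z. norm (K z) powr (p / (p - 1)))"
    "\<And>F. F \<in> rational_near X \<Longrightarrow> (LINT z|lebesgue_on X. F z * K z) = (deriv ^^ t) F x0 / fact t"
proof -
  obtain C where C: "C > 0" "\<And>F. F \<in> rational_off X \<Longrightarrow> norm ((deriv ^^ t) F x0) \<le> C * Lp_norm X p F"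
    using assms(4) unfolding has_bounded_point_derivation_def by blast
  have p: "0 \<le> p" using assms(3) by simp
  show ?thesis
  proof (rule Lp_subspace_functional_representation[of "lebesgue_on X" p "rational_near X" "\<lambda>F. (deriv ^^ t) F x0 / fact t" C])
    show "finite_measure (lebesgue_on X)" using assms(1) by (rule finite_measure_lebesgue_on_compact)
    show "2 \<le> p" by fact
    show "rational_near X \<subseteq> Lp_set (lebesgue_on X) p" using rational_near_Lp[OF assms(1) _ p] by blast
    fix F assume F: "F \<in> rational_near X"
    have aF: "F analytic_on {x0}" using F assms(2) by (rule rational_near_analytic)
    show "(\<lambda>z. F z + c * G z) \<in> rational_near X" if "G \<in> rational_near X" for G c
      using F that by (rule rational_near_lin)
    show "(deriv ^^ t) (\<lambda>z. F z + c * G z) x0 / fact t = (deriv ^^ t) F x0 / fact t + c * ((deriv ^^ t) G x0 / fact t)"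
      if "G \<in> rational_near X" for G c
    proof -
      have aG: "G analytic_on {x0}" using that assms(2) by (rule rational_near_analytic)
      have "(deriv ^^ t) (\<lambda>z. F z + c * G z) x0 = (deriv ^^ t) F x0 + (deriv ^^ t) (\<lambda>z. c * G z) x0"
        by (intro higher_deriv_add_at aF aG analytic_intros)
      then show ?thesis by (simp add: higher_deriv_cmult'[OF aG] add_divide_distrib)
    qed
    show "norm ((deriv ^^ t) F x0 / fact t) \<le> C * pint (lebesgue_on X) p F powr (1 / p)"
    proof -
      obtain P Q where PQ: "\<forall>z\<in>X. poly Q z \<noteq> 0" "\<forall>z. poly Q z \<noteq> 0 \<longrightarrow> F z = poly P z / poly Q z"
        using F unfolding rational_near_def by auto
      define F' where "F' = (\<lambda>z. poly P z / poly Q z)"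
      have "F' \<in> rational_off X"
        unfolding rational_off_def F'_def mem_Collect_eq
        by (rule exI[of _ P], rule exI[of _ Q]) (use PQ(1) assms(2) in auto)
      then have "norm ((deriv ^^ t) F' x0) \<le> C * Lp_norm X p F'" by (rule C(2))
      moreover have "Lp_norm X p F' = pint (lebesgue_on X) p F powr (1 / p)"
        unfolding Lp_norm_def pint_def F'_def using PQ
        by (intro arg_cong[where f = "\<lambda>u. u powr (1 / p)"] Bochner_Integration.integral_cong) auto
      moreover have "(deriv ^^ t) F' x0 = (deriv ^^ t) F x0"
      proof (rule higher_deriv_cong_ev)
        have "\<forall>\<^sub>F z in nhds x0. z \<in> {z. poly Q z \<noteq> 0}"
          using PQ(1) assms(2) by (intro eventually_nhds_in_open open_Collect_neq continuous_intros) auto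
        then show "\<forall>\<^sub>F z in nhds x0. F' z = F z"
          by eventually_elim (use PQ(2) in \<open>auto simp: F'_def\<close>)
      qed auto
      ultimately have "norm ((deriv ^^ t) F x0) \<le> C * pint (lebesgue_on X) p F powr (1 / p)" by simp
      moreover have "norm ((deriv ^^ t) F x0 / fact t) \<le> norm ((deriv ^^ t) F x0)"
        by (simp add: norm_divide divide_le_eq mult_le_cancel_left1)
      ultimately show ?thesis by linarith
    qed
  qed (rule that)
qed

section \<open>Cauchy potentials and their averages over discs\<close>

abbreviation unit_disc_area :: real where
  "unit_disc_area \<equiv> measure lborel (ball (0::complex) 1)"

lemma measure_disc: "0 \<le> r \<Longrightarrow> measure lborel (ball (x::complex) r) = r ^ 2 * unit_disc_area"
  using content_ball_conv_unit_ball[of r x] by simp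

lemma ball_in_sets_borel [measurable]: "ball (x :: complex) r \<in> sets borel"
  by (intro borel_open open_ball)

lemma emeasure_disc:
  assumes "0 \<le> r"
  shows "emeasure lborel (ball (x::complex) r) = ennreal (r ^ 2 * unit_disc_area)"
proof -
  have "emeasure lborel (ball x r) = ennreal (measure lborel (ball x r))"
    by (intro emeasure_eq_ennreal_measure less_imp_neq) (use emeasure_lborel_ball_finite in auto)
  then show ?thesis by (simp only: measure_disc[OF assms])
qed

text \<open>
  The potential with kernel $1/|z-y|$ of area measure on a disc.
\<close>
definition disc_kernel :: "complex \<Rightarrow> real \<Rightarrow> complex \<Rightarrow> ennreal" where
  "disc_kernel x r z = (\<integral>\<^sup>+ y. ennreal (1 / norm (z - y)) * indicator (ball x r) y \<partial>lborel)"

text \<open>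
  On the ring $r/2^{n+1} \le |z-y| < r/2^n$ the integrand is at most $2^{n+1}/r$. Enlarging the ring
  to the disc of radius $r/2^n$, whose area is proportional to $r^2/4^n$, leaves a geometric series.
\<close>
lemma disc_kernel_center:
  assumes r: "0 < r"
  shows "disc_kernel z r z \<le> ennreal (4 * unit_disc_area * r)"
proof -
  let ?g = "\<lambda>n y. ennreal (2 ^ Suc n / r) * indicator (ball z (r / 2 ^ n)) y"
  have pt: "ennreal (1 / norm (z - y)) * indicator (ball z r) y \<le> (\<Sum>n. ?g n y)" for y
  proof (cases "y \<in> ball z r \<and> y \<noteq> z")
    case True
    define d where "d = norm (z - y)"
    have d: "0 < d" "d < r" using True by (auto simp: d_def dist_norm)
    have "(\<lambda>n. r / 2 ^ Suc n) \<longlonglongrightarrow> 0"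
      by (rule LIMSEQ_Suc) (use LIMSEQ_divide_realpow_zero[of 2 r] in simp)
    then have "\<forall>\<^sub>F n in sequentially. r / 2 ^ Suc n < d"
      using d(1) by (rule order_tendstoD(2))
    then have "\<exists>n. r / 2 ^ Suc n \<le> d"
      unfolding eventually_sequentially using less_imp_le by blast
    then obtain n where n: "r / 2 ^ Suc n \<le> d" "\<And>m. m < n \<Longrightarrow> d < r / 2 ^ Suc m"
      unfolding exists_least_iff[of "\<lambda>n. r / 2 ^ Suc n \<le> d"] not_le by blast
    have "d < r / 2 ^ n" using n(2)[of "n - 1"] d(2) by (cases n) auto
    then have ind: "indicator (ball z (r / 2 ^ n)) y = (1::ennreal)" by (simp add: d_def dist_norm)
    have "1 / d \<le> 2 ^ Suc n / r" using n(1) d(1) r by (simp add: field_simps)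
    then have "ennreal (1 / d) \<le> ?g n y" unfolding ind by (simp add: ennreal_leI)
    also have "\<dots> \<le> (\<Sum>n. ?g n y)"
    proof -
      have "f n \<le> suminf f" for f :: "nat \<Rightarrow> ennreal" using sum_le_suminf[of f "{n}"] by simp
      then show ?thesis .
    qed
    finally show ?thesis using True by (simp add: d_def)
  next
    case False
    then show ?thesis by (auto simp: indicator_def)
  qed
  have "disc_kernel z r z \<le> (\<integral>\<^sup>+ y. (\<Sum>n. ?g n y) \<partial>lborel)"
    unfolding disc_kernel_def by (intro nn_integral_mono pt)
  also have "\<dots> = (\<Sum>n. \<integral>\<^sup>+ y. ?g n y \<partial>lborel)"
    by (intro nn_integral_suminf) measurable
  also have "\<dots> = (\<Sum>n. ennreal (2 * unit_disc_area * r * (1 / 2) ^ n))"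
  proof (intro suminf_cong)
    fix n
    have "(\<integral>\<^sup>+ y. ?g n y \<partial>lborel) = ennreal (2 ^ Suc n / r) * ennreal ((r / 2 ^ n) ^ 2 * unit_disc_area)"
      using r by (simp add: nn_integral_cmult_indicator emeasure_disc)
    also have "\<dots> = ennreal (2 ^ Suc n / r * ((r / 2 ^ n) ^ 2 * unit_disc_area))"
      using r by (subst ennreal_mult) auto
    also have "2 ^ Suc n / r * ((r / 2 ^ n) ^ 2 * unit_disc_area) = 2 * unit_disc_area * r * (1 / 2) ^ n"
      using r by (simp add: power2_eq_square power_divide)
    finally show "(\<integral>\<^sup>+ y. ?g n y \<partial>lborel) = ennreal (2 * unit_disc_area * r * (1 / 2) ^ n)" .
  qed
  also have "\<dots> = ennreal (4 * unit_disc_area * r)"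
  proof (rule suminf_ennreal_eq)
    show "(\<lambda>n. 2 * unit_disc_area * r * (1 / 2) ^ n) sums (4 * unit_disc_area * r)"
      using sums_mult[OF geometric_sums[of "1/2::real"], of "2 * unit_disc_area * r"] by (simp add: mult_ac)
  qed (use r in auto)
  finally show ?thesis .
qed

text \<open>
  Uniformly in $z$: near $z$ compare with the disc around $z$, elsewhere with $1/r$.
\<close>
lemma disc_kernel_le:
  assumes r: "0 < r"
  shows "disc_kernel x r z \<le> ennreal (5 * unit_disc_area * r)"
proof -
  have "disc_kernel x r z \<le> (\<integral>\<^sup>+ y. ennreal (1 / norm (z - y)) * indicator (ball z r) y + ennreal (1 / r) * indicator (ball x r) y \<partial>lborel)"
    unfolding disc_kernel_def
  proof (rule nn_integral_mono)
    fix y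
    show "ennreal (1 / norm (z - y)) * indicator (ball x r) y
      \<le> ennreal (1 / norm (z - y)) * indicator (ball z r) y + ennreal (1 / r) * indicator (ball x r) y"
    proof (cases "y \<in> ball x r"; cases "y \<in> ball z r")
      assume "y \<in> ball x r" "y \<notin> ball z r"
      then have "r \<le> norm (z - y)" by (simp add: dist_norm)
      then have "1 / norm (z - y) \<le> 1 / r" using r by (intro frac_le) simp_all
      then have "ennreal (1 / norm (z - y)) \<le> ennreal (1 / r)" by (rule ennreal_leI)
      then show ?thesis using \<open>y \<in> ball x r\<close> \<open>y \<notin> ball z r\<close> by (simp del: mem_ball)
    qed (simp_all del: mem_ball)
  qed
  also have "\<dots> = disc_kernel z r z + ennreal (1 / r) * ennreal (r ^ 2 * unit_disc_area)"
    unfolding disc_kernel_def using r by (subst nn_integral_add) (auto simp: nn_integral_cmult_indicator emeasure_disc)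
  also have "\<dots> \<le> ennreal (4 * unit_disc_area * r) + ennreal (unit_disc_area * r)"
  proof (intro add_mono disc_kernel_center r)
    show "ennreal (1 / r) * ennreal (r ^ 2 * unit_disc_area) \<le> ennreal (unit_disc_area * r)"
      using r by (subst ennreal_mult[symmetric]) (auto simp: power2_eq_square)
  qed
  also have "\<dots> = ennreal (5 * unit_disc_area * r)"
    using r by (subst ennreal_plus[symmetric]) auto
  finally show ?thesis .
qed

lemma disc_kernel_far:
  assumes r: "0 < r" and far: "2 * r \<le> norm (z - x)"
  shows "disc_kernel x r z \<le> ennreal (2 / norm (z - x) * (r ^ 2 * unit_disc_area))"
proof -
  have "disc_kernel x r z \<le> (\<integral>\<^sup>+ y. ennreal (2 / norm (z - x)) * indicator (ball x r) y \<partial>lborel)"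
    unfolding disc_kernel_def
  proof (rule nn_integral_mono)
    fix y
    have "1 / norm (z - y) \<le> 2 / norm (z - x)" if "y \<in> ball x r"
    proof -
      have "norm (z - x) \<le> norm (z - y) + norm (y - x)" using norm_triangle_ineq[of "z - y" "y - x"] by simp
      then have "norm (z - x) \<le> 2 * norm (z - y)" using that far by (simp add: dist_norm norm_minus_commute)
      moreover have "0 < norm (z - x)" using r far by linarith
      ultimately have "norm (z - x) \<le> 2 * norm (z - y)" "0 < norm (z - x)" "0 < norm (z - y)" by linarith+
      then show ?thesis by (simp add: field_simps)
    qed
    then show "ennreal (1 / norm (z - y)) * indicator (ball x r) y \<le> ennreal (2 / norm (z - x)) * indicator (ball x r) y"
      by (cases "y \<in> ball x r") (simp_all add: ennreal_leI del: mem_ball)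
  qed
  also have "\<dots> = ennreal (2 / norm (z - x) * (r ^ 2 * unit_disc_area))"
    using r by (simp add: nn_integral_cmult_indicator emeasure_disc ennreal_mult'[symmetric])
  finally show ?thesis .
qed

text \<open>
  The Cauchy integral of $H$ with absolute values inside. It is always defined, and finiteness at
  $y$ is the condition under which the Cauchy transform at $y$ is a convergent integral.
\<close>
definition cauchy_potential :: "complex set \<Rightarrow> (complex \<Rightarrow> complex) \<Rightarrow> complex \<Rightarrow> ennreal" where
  "cauchy_potential X H y = (\<integral>\<^sup>+ z. ennreal (norm (H z / (z - y))) \<partial>lebesgue_on X)"

lemma pair_measurable_cauchy:
  assumes H: "H \<in> borel_measurable (lebesgue_on X)"
  shows "(\<lambda>(z, y). ennreal (norm (H z / (z - y)))) \<in> borel_measurable (lebesgue_on X \<Otimes>\<^sub>M (lborel :: complex measure))"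
proof -
  have id: "(\<lambda>z. z) \<in> borel_measurable (lebesgue_on X)"
    using id_borel_measurable_lebesgue_on[of X] by (simp add: id_def)
  have "(\<lambda>q. H (fst q)) \<in> borel_measurable (lebesgue_on X \<Otimes>\<^sub>M (lborel :: complex measure))"
    by (rule measurable_compose[OF measurable_fst H])
  moreover have "(\<lambda>q. fst q) \<in> borel_measurable (lebesgue_on X \<Otimes>\<^sub>M (lborel :: complex measure))"
    by (rule measurable_compose[OF measurable_fst id])
  moreover have "(\<lambda>q. snd q) \<in> borel_measurable (lebesgue_on X \<Otimes>\<^sub>M (lborel :: complex measure))"
    by (rule measurable_compose[OF measurable_snd, of "\<lambda>y. y"]) simp
  ultimately show ?thesis
    unfolding case_prod_unfold
    by (intro measurable_compose[OF _ measurable_ennreal] measurable_compose[OF _ borel_measurable_norm] borel_measurable_divide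
        borel_measurable_diff)
qed

lemma cauchy_potential_measurable:
  assumes "compact X" and H: "H \<in> borel_measurable (lebesgue_on X)"
  shows "cauchy_potential X H \<in> borel_measurable lborel"
proof -
  interpret finite_measure "lebesgue_on X"
    using assms(1) by (intro finite_measure_lebesgue_on lmeasurable_compact)
  have "(\<lambda>(y, z). ennreal (norm (H z / (z - y)))) \<in> borel_measurable ((lborel :: complex measure) \<Otimes>\<^sub>M lebesgue_on X)"
    using measurable_pair_swap[OF pair_measurable_cauchy[OF H]] by (simp add: case_prod_unfold)
  then show ?thesis
    unfolding cauchy_potential_def by (rule borel_measurable_nn_integral)
qed

lemma cauchy_potential_disc:
  assumes "compact X" and H: "H \<in> borel_measurable (lebesgue_on X)"
  shows "(\<integral>\<^sup>+ y. cauchy_potential X H y * indicator (ball x r) y \<partial>lborel)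
    = (\<integral>\<^sup>+ z. ennreal (norm (H z)) * disc_kernel x r z \<partial>lebesgue_on X)"
proof -
  interpret L: finite_measure "lebesgue_on X"
    using assms(1) by (intro finite_measure_lebesgue_on lmeasurable_compact)
  interpret pair_sigma_finite "lebesgue_on X" "lborel :: complex measure" ..
  have id: "(\<lambda>z. z) \<in> borel_measurable (lebesgue_on X)"
    using id_borel_measurable_lebesgue_on[of X] by (simp add: id_def)
  have m1: "(\<lambda>z. ennreal (norm (H z / (z - y)))) \<in> borel_measurable (lebesgue_on X)" for y
    by (intro measurable_compose[OF _ measurable_ennreal] measurable_compose[OF _ borel_measurable_norm] borel_measurable_divide
        borel_measurable_diff H id borel_measurable_const)
  have "(\<integral>\<^sup>+ y. cauchy_potential X H y * indicator (ball x r) y \<partial>lborel)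
      = (\<integral>\<^sup>+ y. (\<integral>\<^sup>+ z. ennreal (norm (H z / (z - y))) * indicator (ball x r) y \<partial>lebesgue_on X) \<partial>lborel)"
    unfolding cauchy_potential_def using m1 by (simp add: nn_integral_multc)
  also have "\<dots> = (\<integral>\<^sup>+ z. (\<integral>\<^sup>+ y. ennreal (norm (H z / (z - y))) * indicator (ball x r) y \<partial>lborel) \<partial>lebesgue_on X)"
  proof (rule Fubini')
    have "(\<lambda>q. (case q of (z, y) \<Rightarrow> ennreal (norm (H z / (z - y)))) * indicator (ball x r) (snd q))
        \<in> borel_measurable (lebesgue_on X \<Otimes>\<^sub>M (lborel :: complex measure))"
      by (intro borel_measurable_times_ennreal pair_measurable_cauchy H) measurable
    then show "(\<lambda>(z, y). ennreal (norm (H z / (z - y))) * indicator (ball x r) y)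
        \<in> borel_measurable (lebesgue_on X \<Otimes>\<^sub>M (lborel :: complex measure))"
      by (simp add: case_prod_unfold)
  qed
  also have "\<dots> = (\<integral>\<^sup>+ z. ennreal (norm (H z)) * disc_kernel x r z \<partial>lebesgue_on X)"
    unfolding disc_kernel_def
  proof (intro nn_integral_cong)
    fix z
    have "(\<integral>\<^sup>+ y. ennreal (norm (H z / (z - y))) * indicator (ball x r) y \<partial>lborel)
        = (\<integral>\<^sup>+ y. ennreal (norm (H z)) * (ennreal (1 / norm (z - y)) * indicator (ball x r) y) \<partial>lborel)"
    proof (intro nn_integral_cong)
      fix y
      have "ennreal (norm (H z / (z - y))) = ennreal (norm (H z)) * ennreal (1 / norm (z - y))"
        by (subst ennreal_mult[symmetric]) (auto simp: norm_divide)
      then show "ennreal (norm (H z / (z - y))) * indicator (ball x r) y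
          = ennreal (norm (H z)) * (ennreal (1 / norm (z - y)) * indicator (ball x r) y)"
        by (simp add: mult.assoc)
    qed
    then show "(\<integral>\<^sup>+ y. ennreal (norm (H z / (z - y))) * indicator (ball x r) y \<partial>lborel)
        = ennreal (norm (H z)) * (\<integral>\<^sup>+ y. ennreal (1 / norm (z - y)) * indicator (ball x r) y \<partial>lborel)"
      by (simp add: nn_integral_cmult)
  qed
  finally show ?thesis .
qed

lemma cauchy_potential_integral_le:
  assumes "compact X" and H: "integrable (lebesgue_on X) H" and r: "0 < r"
  shows "(\<integral>\<^sup>+ y. cauchy_potential X H y * indicator (ball x r) y \<partial>lborel)
    \<le> ennreal (5 * unit_disc_area * r * (LINT z|lebesgue_on X. norm (H z)))"
proof -
  note [measurable] = borel_measurable_integrable[OF H]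
  have "(\<integral>\<^sup>+ y. cauchy_potential X H y * indicator (ball x r) y \<partial>lborel)
      \<le> (\<integral>\<^sup>+ z. ennreal (norm (H z)) * ennreal (5 * unit_disc_area * r) \<partial>lebesgue_on X)"
    unfolding cauchy_potential_disc[OF assms(1) borel_measurable_integrable[OF H]]
    by (intro nn_integral_mono mult_left_mono disc_kernel_le r) auto
  also have "\<dots> = ennreal (LINT z|lebesgue_on X. norm (H z)) * ennreal (5 * unit_disc_area * r)"
    using H by (simp add: nn_integral_multc nn_integral_eq_integral)
  also have "\<dots> = ennreal (5 * unit_disc_area * r * (LINT z|lebesgue_on X. norm (H z)))"
    using r by (subst ennreal_mult[symmetric]) (auto simp: mult.commute)
  finally show ?thesis .
qed

lemma AE_lebesgue_on_neq:
  fixes y :: complex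
  assumes "compact X"
  shows "AE z in lebesgue_on X. z \<noteq> y"
proof -
  have "{y} \<in> null_sets lebesgue" by simp
  then have "AE z in lebesgue. z \<notin> {y}" by (rule AE_not_in)
  then show ?thesis
    using assms by (subst AE_restrict_space_iff) (auto intro: fmeasurableD lmeasurable_compact)
qed

lemma disc_kernel_measurable:
  "(\<lambda>z. disc_kernel x r z) \<in> borel_measurable (lebesgue_on X)"
proof -
  have "(\<lambda>(z, y). ennreal (norm (1 / (z - y))) * indicator (ball x r) y)
      \<in> borel_measurable (lebesgue_on X \<Otimes>\<^sub>M (lborel :: complex measure))"
  proof -
    have "(\<lambda>q. (case q of (z, y) \<Rightarrow> ennreal (norm (1 / (z - y)))) * indicator (ball x r) (snd q))
        \<in> borel_measurable (lebesgue_on X \<Otimes>\<^sub>M (lborel :: complex measure))"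
      by (intro borel_measurable_times_ennreal pair_measurable_cauchy[of "\<lambda>_. 1"] borel_measurable_const) measurable
    then show ?thesis by (simp add: case_prod_unfold)
  qed
  then have "(\<lambda>z. \<integral>\<^sup>+ y. ennreal (norm (1 / (z - y))) * indicator (ball x r) y \<partial>lborel) \<in> borel_measurable (lebesgue_on X)"
    by (rule lborel.borel_measurable_nn_integral)
  then show ?thesis by (simp add: disc_kernel_def norm_divide)
qed

text \<open>
  By Fubini's theorem the average is at most the integral of $|H(z)|$ times $1/r$ times the disc
  kernel. That factor is bounded by \<open>disc_kernel_le\<close> and tends to $0$ for each $z \neq x$ by
  \<open>disc_kernel_far\<close>.
\<close>
lemma cauchy_potential_average_tendsto_0:
  assumes "compact X" and H: "integrable (lebesgue_on X) H"
  shows "((\<lambda>r. ennreal (1 / r^2) * (\<integral>\<^sup>+ y. ennreal (norm (y - x)) * cauchy_potential X H y * indicator (ball x r) y \<partial>lborel))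
    \<longlongrightarrow> 0) (at_right 0)"
proof (rule tendsto_at_right_sequentially[of 0 1])
  fix S :: "nat \<Rightarrow> real" assume S: "\<And>n. 0 < S n" "S \<longlonglongrightarrow> 0"
  note Hm = borel_measurable_integrable[OF H]
  have Hn: "(\<lambda>z. ennreal (norm (H z))) \<in> borel_measurable (lebesgue_on X)"
    by (intro measurable_compose[OF _ measurable_ennreal] measurable_compose[OF Hm borel_measurable_norm])
  define k where "k = (\<lambda>r z. ennreal (norm (H z)) * (ennreal (1 / r) * disc_kernel x r z))"
  have le: "ennreal (1 / r^2) * (\<integral>\<^sup>+ y. ennreal (norm (y - x)) * cauchy_potential X H y * indicator (ball x r) y \<partial>lborel)
      \<le> (\<integral>\<^sup>+ z. k r z \<partial>lebesgue_on X)" if "r > 0" for r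
  proof -
    have "(\<integral>\<^sup>+ y. ennreal (norm (y - x)) * cauchy_potential X H y * indicator (ball x r) y \<partial>lborel)
        \<le> (\<integral>\<^sup>+ y. ennreal r * (cauchy_potential X H y * indicator (ball x r) y) \<partial>lborel)"
    proof (rule nn_integral_mono)
      fix y
      show "ennreal (norm (y - x)) * cauchy_potential X H y * indicator (ball x r) y
          \<le> ennreal r * (cauchy_potential X H y * indicator (ball x r) y)"
      proof (cases "y \<in> ball x r")
        case True
        then have "ennreal (norm (y - x)) \<le> ennreal r"
          by (intro ennreal_leI) (simp add: dist_norm norm_minus_commute)
        then show ?thesis using True by (simp del: mem_ball add: mult_right_mono)
      qed (simp del: mem_ball)
    qed
    also have "\<dots> = ennreal r * (\<integral>\<^sup>+ y. cauchy_potential X H y * indicator (ball x r) y \<partial>lborel)"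
      by (intro nn_integral_cmult borel_measurable_times_ennreal cauchy_potential_measurable[OF assms(1) Hm]
          borel_measurable_indicator) auto
    also have "\<dots> = ennreal r * (\<integral>\<^sup>+ z. ennreal (norm (H z)) * disc_kernel x r z \<partial>lebesgue_on X)"
      by (simp only: cauchy_potential_disc[OF assms(1) Hm])
    finally have "ennreal (1 / r^2) * (\<integral>\<^sup>+ y. ennreal (norm (y - x)) * cauchy_potential X H y * indicator (ball x r) y \<partial>lborel)
        \<le> ennreal (1 / r^2) * (ennreal r * (\<integral>\<^sup>+ z. ennreal (norm (H z)) * disc_kernel x r z \<partial>lebesgue_on X))"
      by (rule mult_left_mono) simp
    also have "\<dots> = ennreal (1 / r) * (\<integral>\<^sup>+ z. ennreal (norm (H z)) * disc_kernel x r z \<partial>lebesgue_on X)"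
    proof -
      have "ennreal (1 / r^2) * ennreal r = ennreal (1 / r)"
        using that by (subst ennreal_mult[symmetric]) (auto simp: power2_eq_square)
      then show ?thesis by (simp only: mult.assoc[symmetric])
    qed
    also have "\<dots> = (\<integral>\<^sup>+ z. ennreal (1 / r) * (ennreal (norm (H z)) * disc_kernel x r z) \<partial>lebesgue_on X)"
      by (intro nn_integral_cmult[symmetric] borel_measurable_times_ennreal disc_kernel_measurable Hn)
    also have "\<dots> = (\<integral>\<^sup>+ z. k r z \<partial>lebesgue_on X)"
      unfolding k_def by (simp only: mult.left_commute)
    finally show ?thesis .
  qed
  have k_le: "k r z \<le> ennreal (norm (H z)) * ennreal (5 * unit_disc_area)" if "r > 0" for r z
  proof -
    have "ennreal (1 / r) * disc_kernel x r z \<le> ennreal (1 / r) * ennreal (5 * unit_disc_area * r)"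
      by (intro mult_left_mono disc_kernel_le that) simp
    also have "\<dots> = ennreal (5 * unit_disc_area)"
      using that by (subst ennreal_mult[symmetric]) auto
    finally show ?thesis unfolding k_def by (rule mult_left_mono) simp
  qed
  have "(\<lambda>n. \<integral>\<^sup>+ z. k (S n) z \<partial>lebesgue_on X) \<longlonglongrightarrow> (\<integral>\<^sup>+ z. 0 \<partial>lebesgue_on X)"
  proof (rule nn_integral_dominated_convergence)
    show "k (S n) \<in> borel_measurable (lebesgue_on X)" for n
      unfolding k_def by (intro borel_measurable_times_ennreal disc_kernel_measurable Hn borel_measurable_const)
    show "(\<lambda>z. ennreal (norm (H z)) * ennreal (5 * unit_disc_area)) \<in> borel_measurable (lebesgue_on X)"
      by (intro borel_measurable_times_ennreal Hn borel_measurable_const)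
    show "AE z in lebesgue_on X. k (S n) z \<le> ennreal (norm (H z)) * ennreal (5 * unit_disc_area)" for n
      using k_le S by simp
    have "(\<integral>\<^sup>+ z. ennreal (norm (H z)) * ennreal (5 * unit_disc_area) \<partial>lebesgue_on X)
        = (\<integral>\<^sup>+ z. ennreal (norm (H z)) \<partial>lebesgue_on X) * ennreal (5 * unit_disc_area)"
      by (intro nn_integral_multc Hn)
    also have "\<dots> < \<infinity>"
      using H by (simp add: integrable_iff_bounded ennreal_mult_less_top)
    finally show "(\<integral>\<^sup>+ z. ennreal (norm (H z)) * ennreal (5 * unit_disc_area) \<partial>lebesgue_on X) < \<infinity>" .
    have ptw: "(\<lambda>n. k (S n) z) \<longlonglongrightarrow> 0" if "z \<noteq> x" for z
    proof (rule tendsto_sandwich[OF _ _ tendsto_const])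
      define c where "c = norm (H z) * (2 / norm (z - x) * unit_disc_area)"
      have "(\<lambda>n. ennreal (c * S n)) \<longlonglongrightarrow> ennreal (c * 0)"
        using S(2) by (intro tendsto_ennrealI tendsto_intros)
      then show "(\<lambda>n. ennreal (c * S n)) \<longlonglongrightarrow> 0" by simp
      have "0 < norm (z - x) / 2" using that by simp
      from order_tendstoD(2)[OF S(2) this] show "\<forall>\<^sub>F n in sequentially. k (S n) z \<le> ennreal (c * S n)"
      proof eventually_elim
        case (elim n)
        have "k (S n) z \<le> ennreal (norm (H z)) * (ennreal (1 / S n) * ennreal (2 / norm (z - x) * ((S n)^2 * unit_disc_area)))"
          unfolding k_def using elim S(1) by (intro mult_left_mono disc_kernel_far) auto
        also have "\<dots> = ennreal (norm (H z) * (1 / S n * (2 / norm (z - x) * ((S n)^2 * unit_disc_area))))"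
          using S(1)[of n] by (subst ennreal_mult[symmetric], simp, simp, subst ennreal_mult[symmetric]) auto
        also have "norm (H z) * (1 / S n * (2 / norm (z - x) * ((S n)^2 * unit_disc_area))) = c * S n"
          using S(1)[of n] by (simp add: c_def power2_eq_square)
        finally show ?case .
      qed
    qed auto
    have "AE z in lebesgue_on X. z \<noteq> x" by (rule AE_lebesgue_on_neq[OF assms(1)])
    then show "AE z in lebesgue_on X. (\<lambda>n. k (S n) z) \<longlonglongrightarrow> 0"
      by eventually_elim (rule ptw)
  qed auto
  then have "(\<lambda>n. \<integral>\<^sup>+ z. k (S n) z \<partial>lebesgue_on X) \<longlonglongrightarrow> 0" by simp
  then show "(\<lambda>n. ennreal (1 / (S n)^2) * (\<integral>\<^sup>+ y. ennreal (norm (y - x)) * cauchy_potential X H y * indicator (ball x (S n)) y \<partial>lborel)) \<longlonglongrightarrow> 0"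
    by (rule tendsto_sandwich[OF _ _ tendsto_const, rotated 2]) (use le S in auto)
qed simp

section \<open>Points of full area density\<close>

text \<open>
  The radius is a real variable, unlike in \<open>full_area_density_at_0\<close>, so that the notion is
  invariant under dilations. Up to a constant, $r^2$ is the area of the disc.
\<close>
definition density_point :: "complex set \<Rightarrow> complex \<Rightarrow> bool" where
  "density_point E x \<longleftrightarrow> E \<in> sets lebesgue \<and>
     ((\<lambda>r. measure lebesgue (ball x r - E) / r^2) \<longlongrightarrow> 0) (at_right 0)"

lemma density_pointI:
  assumes "E \<in> sets lebesgue" "(u \<longlongrightarrow> 0) (at_right 0)"
    "\<And>r. r > 0 \<Longrightarrow> measure lebesgue (ball x r - E) / r^2 \<le> u r"
  shows "density_point E x"
  unfolding density_point_def
proof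
  show "((\<lambda>r. measure lebesgue (ball x r - E) / r^2) \<longlongrightarrow> 0) (at_right 0)"
    by (rule tendsto_sandwich[OF _ _ tendsto_const assms(2)])
      (use assms(3) in \<open>auto intro!: eventually_at_rightI[of 0 1]\<close>)
qed fact

lemma ball_diff_lmeasurable: "E \<in> sets lebesgue \<Longrightarrow> ball x r - E \<in> lmeasurable" for x :: complex
  by (intro fmeasurable_Diff) auto

lemma density_point_Int:
  assumes "density_point E x" "density_point F x"
  shows "density_point (E \<inter> F) x"
proof (rule density_pointI)
  show EF: "E \<inter> F \<in> sets lebesgue" using assms by (auto simp: density_point_def)
  show "((\<lambda>r. measure lebesgue (ball x r - E) / r^2 + measure lebesgue (ball x r - F) / r^2) \<longlongrightarrow> 0) (at_right 0)"
    using assms by (auto simp: density_point_def intro!: tendsto_add_zero)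
  fix r :: real assume "r > 0"
  have "ball x r - E \<inter> F = (ball x r - E) \<union> (ball x r - F)" by auto
  also have "measure lebesgue \<dots> \<le> measure lebesgue (ball x r - E) + measure lebesgue (ball x r - F)"
    using assms by (intro measure_Un_le fmeasurableD[OF ball_diff_lmeasurable]) (auto simp: density_point_def)
  finally show "measure lebesgue (ball x r - E \<inter> F) / r^2 \<le> measure lebesgue (ball x r - E) / r^2 + measure lebesgue (ball x r - F) / r^2"
    by (simp add: divide_right_mono flip: add_divide_distrib)
qed

lemma density_point_INT:
  assumes "finite S" "S \<noteq> {}" "\<And>s. s \<in> S \<Longrightarrow> density_point (E s) x"
  shows "density_point (\<Inter>s\<in>S. E s) x"
  using assms by (induction S rule: finite_ne_induct) (auto intro: density_point_Int)

lemma density_point_minus_null: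
  assumes E: "density_point E x" and N: "N \<in> null_sets lebesgue"
  shows "density_point (E - N) x"
proof (rule density_pointI)
  show EN: "E - N \<in> sets lebesgue" using assms by (auto simp: density_point_def)
  show "((\<lambda>r. measure lebesgue (ball x r - E) / r^2) \<longlongrightarrow> 0) (at_right 0)" using E by (simp add: density_point_def)
  fix r :: real
  have Nf: "N \<in> lmeasurable" using N by (auto simp: fmeasurable_def null_sets_def)
  have "measure lebesgue (ball x r - (E - N)) \<le> measure lebesgue ((ball x r - E) \<union> N)"
    using E by (intro measure_mono_fmeasurable fmeasurable.Un Nf fmeasurableD[OF ball_diff_lmeasurable[OF EN]]
        ball_diff_lmeasurable) (auto simp: density_point_def)
  also have "\<dots> \<le> measure lebesgue (ball x r - E) + measure lebesgue N"
    using assms by (intro measure_Un_le fmeasurableD[OF ball_diff_lmeasurable]) (auto simp: density_point_def)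
  also have "measure lebesgue N = 0" using N by (simp add: null_sets_def measure_def)
  finally show "measure lebesgue (ball x r - (E - N)) / r^2 \<le> measure lebesgue (ball x r - E) / r^2"
    by (simp add: divide_right_mono)
qed

lemma density_point_sublevel:
  assumes u: "u \<in> borel_measurable lborel" and c: "c > 0"
    and avg: "((\<lambda>r. ennreal (1 / r^2) * (\<integral>\<^sup>+ y. u y * indicator (ball x r) y \<partial>lborel)) \<longlongrightarrow> 0) (at_right 0)"
  shows "density_point {y. u y \<le> ennreal c} x"
  unfolding density_point_def
proof
  let ?E = "{y. u y \<le> ennreal c}"
  note [measurable] = u
  have Eb: "?E \<in> sets lborel" by measurable
  then show E: "?E \<in> sets lebesgue" by auto
  have "((\<lambda>r. ennreal (1 / c) * (ennreal (1 / r^2) * (\<integral>\<^sup>+ y. u y * indicator (ball x r) y \<partial>lborel))) \<longlongrightarrow> ennreal (1 / c) * 0) (at_right 0)"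
    using avg by (intro ennreal_tendsto_cmult) auto
  then have lim: "((\<lambda>r. ennreal (1 / c) * (ennreal (1 / r^2) * (\<integral>\<^sup>+ y. u y * indicator (ball x r) y \<partial>lborel))) \<longlongrightarrow> 0) (at_right 0)"
    by simp
  have le: "ennreal (measure lebesgue (ball x r - ?E) / r^2)
     \<le> ennreal (1 / c) * (ennreal (1 / r^2) * (\<integral>\<^sup>+ y. u y * indicator (ball x r) y \<partial>lborel))" if "r > 0" for r
  proof -
    have "ennreal (measure lebesgue (ball x r - ?E)) = emeasure lborel (ball x r - ?E)"
      using emeasure_eq_measure2[OF ball_diff_lmeasurable[OF E]] Eb by simp
    also have "\<dots> \<le> emeasure lborel {y \<in> ball x r. 1 \<le> ennreal (1 / c) * u y}"
    proof (rule emeasure_mono)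
      have "1 \<le> ennreal (1 / c) * u y" if "\<not> u y \<le> ennreal c" for y
      proof -
        have "1 = ennreal (1 / c) * ennreal c" using c by (subst ennreal_mult[symmetric]) auto
        also have "\<dots> \<le> ennreal (1 / c) * u y" using that by (intro mult_left_mono) auto
        finally show ?thesis .
      qed
      then show "ball x r - ?E \<subseteq> {y \<in> ball x r. 1 \<le> ennreal (1 / c) * u y}" by auto
      show "{y \<in> ball x r. 1 \<le> ennreal (1 / c) * u y} \<in> sets lborel" by measurable
    qed
    also have "\<dots> \<le> ennreal (1 / c) * (\<integral>\<^sup>+ y. u y * indicator (ball x r) y \<partial>lborel)"
      by (rule nn_integral_Markov_inequality) measurable
    finally have "ennreal (1 / r^2) * ennreal (measure lebesgue (ball x r - ?E))
        \<le> ennreal (1 / r^2) * (ennreal (1 / c) * (\<integral>\<^sup>+ y. u y * indicator (ball x r) y \<partial>lborel))"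
      by (rule mult_left_mono) simp
    moreover have "ennreal (1 / r^2) * ennreal (measure lebesgue (ball x r - ?E)) = ennreal (measure lebesgue (ball x r - ?E) / r^2)"
      by (subst ennreal_mult[symmetric]) auto
    ultimately show ?thesis by (simp only: mult.left_commute)
  qed
  have "((\<lambda>r. ennreal (measure lebesgue (ball x r - ?E) / r^2)) \<longlongrightarrow> ennreal 0) (at_right 0)"
    by (rule tendsto_sandwich[OF _ _ tendsto_const, rotated 2])
      (use lim in simp, simp, use le in \<open>auto intro!: eventually_at_rightI[of 0 1]\<close>)
  then show "((\<lambda>r. measure lebesgue (ball x r - ?E) / r^2) \<longlongrightarrow> 0) (at_right 0)"
    by (subst (asm) tendsto_ennreal_iff) auto
qed

text \<open>
  Choose radii $R_n$ such that the complement of $A_n$ fills at most the proportion $2^{-n}$ of all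
  discs smaller than $R_n$, and require membership in $A_n$ only within distance $R_n$ of $x$. The
  relative measures of the complements are then dominated by a summable sequence, so their sum
  tends to $0$ because each of them does (Tannery).
\<close>
lemma density_point_diagonal:
  fixes A :: "nat \<Rightarrow> complex set"
  assumes A: "\<And>n. density_point (A n) x"
  obtains E where "density_point E x" "\<And>n. \<exists>r>0. E \<inter> ball x r \<subseteq> A n"
proof -
  have "\<exists>r>0. \<forall>s. 0 < s \<and> s < r \<longrightarrow> measure lebesgue (ball x s - A n) / s^2 < (1/2)^n" for n :: nat
  proof -
    have "\<forall>\<^sub>F s in at_right 0. measure lebesgue (ball x s - A n) / s^2 < (1/2)^n"
      using A[of n] by (intro order_tendstoD(2)[of _ 0]) (auto simp: density_point_def)
    then show ?thesis by (auto simp: eventually_at_right_field)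
  qed
  then obtain \<rho> where \<rho>: "\<And>n. \<rho> n > 0"
    "\<And>n s. 0 < s \<Longrightarrow> s < \<rho> n \<Longrightarrow> measure lebesgue (ball x s - A n) / s^2 < (1/2)^n"
    by metis
  define R where "R = (\<lambda>n. \<rho> n / 2)"
  have R: "R n > 0" "R n < \<rho> n" for n using \<rho>(1)[of n] by (auto simp: R_def)
  define E where "E = (\<Inter>n. A n \<union> - ball x (R n))"
  have Am: "A n \<in> sets lebesgue" for n using A[of n] by (simp add: density_point_def)
  have Em: "E \<in> sets lebesgue" unfolding E_def using Am by (intro sets.countable_INT) auto
  define a where "a = (\<lambda>n r. measure lebesgue (ball x (min r (R n)) - A n) / r^2)"
  have a_le: "a n r \<le> (1/2)^n" if "r > 0" for n r
  proof -
    have m: "0 < min r (R n)" "min r (R n) < \<rho> n" using that R[of n] by auto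
    have "measure lebesgue (ball x (min r (R n)) - A n) \<le> (1/2)^n * (min r (R n))^2"
      using \<rho>(2)[OF m] m(1) by (simp add: field_simps)
    also have "\<dots> \<le> (1/2)^n * r^2" using m(1) by (intro mult_left_mono power_mono) auto
    finally show ?thesis using that by (simp add: a_def field_simps)
  qed
  have a_0: "((\<lambda>r. a n r) \<longlongrightarrow> 0) (at_right 0)" for n
  proof (rule tendsto_sandwich[OF _ _ tendsto_const])
    show "((\<lambda>r. measure lebesgue (ball x r - A n) / r^2) \<longlongrightarrow> 0) (at_right 0)"
      using A[of n] by (simp add: density_point_def)
    show "\<forall>\<^sub>F r in at_right 0. a n r \<le> measure lebesgue (ball x r - A n) / r^2"
      unfolding a_def
      by (intro always_eventually allI divide_right_mono measure_mono_fmeasurable ball_diff_lmeasurable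
          fmeasurableD Am) auto
  qed (simp add: a_def)
  have "((\<lambda>r. \<Sum>n. a n r) \<longlongrightarrow> (\<Sum>n. 0)) (at_right 0)"
  proof (rule tannerys_theorem[THEN conjunct2, THEN conjunct2])
    show "summable (\<lambda>n. (1/2::real)^n)" by (simp add: summable_geometric)
    have "\<forall>\<^sub>F (k :: nat, r :: real) in at_top \<times>\<^sub>F at_right 0. r > 0"
      by (subst eventually_prod2) (simp_all add: eventually_at_right_less)
    then show "\<forall>\<^sub>F (k, r) in at_top \<times>\<^sub>F at_right 0. norm (a k r) \<le> (1/2)^k"
      by eventually_elim (auto simp: abs_of_nonneg a_le, auto simp: a_def a_le[unfolded a_def])
  qed (use a_0 in auto)
  then have lim: "((\<lambda>r. \<Sum>n. a n r) \<longlongrightarrow> 0) (at_right 0)" by simp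
  show ?thesis
  proof (rule that)
    show "density_point E x"
    proof (rule density_pointI[OF Em lim])
      fix r :: real assume r: "r > 0"
      have a_summable: "summable (\<lambda>n. a n r)"
        by (rule summable_comparison_test'[of "\<lambda>n. (1/2)^n"])
          (use a_le[OF r] in \<open>auto simp: a_def summable_geometric\<close>)
      have "ball x r - E = (\<Union>n. ball x (min r (R n)) - A n)"
        unfolding E_def by auto
      also have "measure lebesgue \<dots> \<le> (\<Sum>n. measure lebesgue (ball x (min r (R n)) - A n))"
      proof (rule measure_subadditive_countably)
        show "range (\<lambda>n. ball x (min r (R n)) - A n) \<subseteq> sets lebesgue" using Am by auto
        have "emeasure lebesgue (ball x (min r (R n)) - A n) = ennreal (r^2 * a n r)" for n
          using emeasure_eq_measure2[OF ball_diff_lmeasurable[OF Am]] r by (simp add: a_def)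
        then have "(\<Sum>n. emeasure lebesgue (ball x (min r (R n)) - A n)) = (\<Sum>n. ennreal (r^2 * a n r))"
          by (simp only:)
        also have "\<dots> \<noteq> top"
        proof (rule ennreal_suminf_neq_top)
          show "summable (\<lambda>n. r^2 * a n r)" by (rule summable_mult[OF a_summable])
        qed (simp add: a_def)
        finally show "(\<Sum>n. emeasure lebesgue (ball x (min r (R n)) - A n)) \<noteq> \<infinity>" by simp
      qed
      also have "\<dots> = (\<Sum>n. r^2 * a n r)" using r by (simp add: a_def)
      also have "\<dots> = r^2 * (\<Sum>n. a n r)" using a_summable by (rule suminf_mult)
      finally show "measure lebesgue (ball x r - E) / r^2 \<le> (\<Sum>n. a n r)"
        using r by (simp add: field_simps)
    qed
    show "\<exists>r>0. E \<inter> ball x r \<subseteq> A n" for n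
      using R(1)[of n] by (intro exI[of _ "R n"]) (auto simp: E_def)
  qed
qed

lemma density_point_scale:
  assumes E: "density_point E x" and s: "s > 0"
  shows "density_point {h. x + of_real s * h \<in> E} 0"
proof -
  let ?E = "{h. x + of_real s * h \<in> E}"
  have img: "(\<lambda>h. s *\<^sub>R h + x) ` ?E = E"
  proof (intro equalityI subsetI)
    fix y assume "y \<in> E"
    then have "(y - x) / of_real s \<in> ?E" "y = s *\<^sub>R ((y - x) / of_real s) + x"
      using s by (auto simp: scaleR_conv_of_real)
    then show "y \<in> (\<lambda>h. s *\<^sub>R h + x) ` ?E" by blast
  qed (auto simp: scaleR_conv_of_real add.commute)
  have "(\<lambda>h. of_real s * h + x) -` E \<inter> space lebesgue \<in> sets lebesgue"
  proof (rule measurable_sets)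
    have "(\<lambda>h::complex. x + (\<Sum>j\<in>Basis. (s * (h \<bullet> j)) *\<^sub>R j)) \<in> lebesgue \<rightarrow>\<^sub>M lebesgue"
      using s by (intro lebesgue_affine_measurable) auto
    also have "(\<lambda>h::complex. x + (\<Sum>j\<in>Basis. (s * (h \<bullet> j)) *\<^sub>R j)) = (\<lambda>h. of_real s * h + x)"
      unfolding scaleR_scaleR[symmetric] scaleR_sum_right[symmetric] euclidean_representation
      by (simp add: scaleR_conv_of_real add.commute)
    finally show "(\<lambda>h. of_real s * h + x) \<in> lebesgue \<rightarrow>\<^sub>M lebesgue" .
    show "E \<in> sets lebesgue" using E by (simp add: density_point_def)
  qed
  then have Em: "?E \<in> sets lebesgue" by (simp add: vimage_def add.commute)
  have ms: "measure lebesgue (ball x (s * r) - E) = s^2 * measure lebesgue (ball 0 r - ?E)" for r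
  proof -
    have "(\<lambda>h. s *\<^sub>R h + x) ` (ball 0 r - ?E) = ball x (s * r) - E"
    proof (intro equalityI subsetI)
      fix y assume y: "y \<in> ball x (s * r) - E"
      have eq: "y = s *\<^sub>R ((y - x) / of_real s) + x"
        using s by (auto simp: scaleR_conv_of_real)
      moreover have "(y - x) / of_real s \<in> ball 0 r - ?E"
        using y s by (auto simp: dist_norm norm_divide norm_minus_commute field_simps)
      ultimately show "y \<in> (\<lambda>h. s *\<^sub>R h + x) ` (ball 0 r - ?E)" by blast
    qed (use s in \<open>auto simp: scaleR_conv_of_real add.commute dist_norm norm_mult\<close>)
    then show ?thesis using measure_lebesgue_affine[of s x "ball 0 r - ?E"] by simp
  qed
  have "filterlim (\<lambda>r. s * r) (at_right 0) (at_right 0)"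
    using s by (auto simp: filterlim_at intro!: tendsto_eq_intros eventually_at_rightI[of 0 1])
  with E have "((\<lambda>r. measure lebesgue (ball x (s * r) - E) / (s * r)^2) \<longlongrightarrow> 0) (at_right 0)"
    unfolding density_point_def using filterlim_compose by blast
  also have "(\<lambda>r. measure lebesgue (ball x (s * r) - E) / (s * r)^2) = (\<lambda>r. measure lebesgue (ball 0 r - ?E) / r^2)"
    using s by (simp add: ms power_mult_distrib)
  finally show ?thesis using Em by (simp add: density_point_def)
qed

lemma density_point_imp_full_area_density:
  assumes "density_point E 0"
  shows "full_area_density_at_0 E"
  unfolding full_area_density_at_0_def
proof
  show "E \<in> sets lebesgue" using assms by (simp add: density_point_def)
  have "filterlim (\<lambda>n. 1 / real n) (at_right 0) sequentially"
    unfolding filterlim_at using lim_1_over_n by (auto simp: eventually_at_top_linorder intro!: exI[of _ 1])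
  with assms have "(\<lambda>n. measure lebesgue (ball 0 (1 / real n) - E) / (1 / real n)^2) \<longlonglongrightarrow> 0"
    unfolding density_point_def using filterlim_compose by blast
  then have "(\<lambda>n. measure lebesgue (ball 0 (1 / real n) - E) / (1 / real n)^2 / unit_disc_area) \<longlonglongrightarrow> 0 / unit_disc_area"
    by (intro tendsto_divide tendsto_const) (auto simp: content_ball_pos less_imp_neq[symmetric])
  moreover have "measure lebesgue (ball (0::complex) (1 / real n)) = (1 / real n)^2 * unit_disc_area" for n
    using measure_disc[of "1 / real n" 0] by simp
  ultimately show "(\<lambda>n. measure lebesgue (ball 0 (1 / real n) - E) / measure lebesgue (ball (0::complex) (1 / real n))) \<longlonglongrightarrow> 0"
    by simp
qed

section \<open>The Taylor identity in $R^p(X)$\<close>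

lemma Lp_set_mult_rational:
  assumes "compact X" "g \<in> rational_near X" "f \<in> Lp_set (lebesgue_on X) p" "0 \<le> p"
  shows "(\<lambda>z. g z * f z) \<in> Lp_set (lebesgue_on X) p"
proof -
  note [measurable] = rational_near_measurable[OF assms(1,2)] Lp_setD(1)[OF assms(3)]
  obtain B where B: "\<And>z. z \<in> X \<Longrightarrow> norm (g z) \<le> B" using rational_near_bounded assms by blast
  have "integrable (lebesgue_on X) (\<lambda>z. norm (g z * f z) powr p)"
  proof (rule Bochner_Integration.integrable_bound)
    show "integrable (lebesgue_on X) (\<lambda>z. B powr p * norm (f z) powr p)"
      by (intro integrable_mult_right Lp_setD(2) assms)
    show "AE z in lebesgue_on X. norm (norm (g z * f z) powr p) \<le> norm (B powr p * norm (f z) powr p)"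
    proof (rule AE_I2)
      fix z assume "z \<in> space (lebesgue_on X)"
      then have "norm (g z) powr p \<le> B powr p" using B assms(4) by (intro powr_mono2) auto
      then show "norm (norm (g z * f z) powr p) \<le> norm (B powr p * norm (f z) powr p)"
        by (simp add: norm_mult powr_mult mult_right_mono)
    qed
  qed measurable
  then show ?thesis by (simp add: Lp_set_def)
qed

definition cauchy_transform :: "complex set \<Rightarrow> (complex \<Rightarrow> complex) \<Rightarrow> complex \<Rightarrow> complex" where
  "cauchy_transform X H y = (LINT z|lebesgue_on X. H z / (z - y))"

lemma integrable_cauchy_kernel:
  assumes H: "H \<in> borel_measurable (lebesgue_on X)" and fin: "cauchy_potential X H y < \<infinity>"
  shows "integrable (lebesgue_on X) (\<lambda>z. H z / (z - y))"
proof (rule integrableI_bounded)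
  have id: "(\<lambda>z. z) \<in> borel_measurable (lebesgue_on X)"
    using id_borel_measurable_lebesgue_on[of X] by (simp add: id_def)
  show "(\<lambda>z. H z / (z - y)) \<in> borel_measurable (lebesgue_on X)"
    by (intro borel_measurable_divide borel_measurable_diff H id borel_measurable_const)
qed (use fin in \<open>simp add: cauchy_potential_def\<close>)

lemma norm_cauchy_transform_le: "ennreal (norm (cauchy_transform X H y)) \<le> cauchy_potential X H y"
proof (cases "integrable (lebesgue_on X) (\<lambda>z. H z / (z - y))")
  case True
  then show ?thesis unfolding cauchy_transform_def cauchy_potential_def by (rule integral_norm_bound_ennreal)
next
  case False
  then show ?thesis by (simp add: cauchy_transform_def not_integrable_integral_eq)
qed

lemma nn_integral_lebesgue_on_le_ball:
  fixes x :: complex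
  assumes "compact X" "X \<subseteq> ball x R"
  shows "(\<integral>\<^sup>+ y. u y \<partial>lebesgue_on X) \<le> (\<integral>\<^sup>+ y. u y * indicator (ball x R) y \<partial>lborel)"
proof -
  have "(\<integral>\<^sup>+ y. u y \<partial>lebesgue_on X) = (\<integral>\<^sup>+ y. u y * indicator X y \<partial>lebesgue)"
    using assms(1) by (intro nn_integral_restrict_space) (auto intro: fmeasurableD lmeasurable_compact)
  also have "\<dots> \<le> (\<integral>\<^sup>+ y. u y * indicator (ball x R) y \<partial>lebesgue)"
    using assms(2) by (intro nn_integral_mono mult_left_mono) (auto simp: indicator_def)
  finally show ?thesis by (simp add: nn_integral_completion)
qed

text \<open>
  The setting of the Taylor expansion. Multiplication by $K$ maps $L^p$ into $L^1$, which is how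
  approximation in $L^p$ becomes convergence of the integrals below.
\<close>
locale derivation_kernel =
  fixes X :: "complex set" and x0 :: complex and t :: nat and p :: real and K :: "complex \<Rightarrow> complex"
  assumes compact_X: "compact X" and x0_in_X: "x0 \<in> X" and p_gt_1: "1 < p"
    and K_measurable: "K \<in> borel_measurable (lebesgue_on X)"
    and K_integrable: "integrable (lebesgue_on X) (\<lambda>z. norm (K z) powr (p / (p - 1)))"
    and K_rep: "\<And>F. F \<in> rational_near X \<Longrightarrow> (LINT z|lebesgue_on X. F z * K z) = (deriv ^^ t) F x0 / fact t"
begin

abbreviation "L \<equiv> lebesgue_on X"

lemma p_nonneg: "0 \<le> p" using p_gt_1 by simp

lemma rational_Lp: "F \<in> rational_near X \<Longrightarrow> F \<in> Lp_set L p"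
  by (rule rational_near_Lp[OF compact_X _ p_nonneg])

lemma weighted_Lp: "f \<in> Lp_set L p \<Longrightarrow> (\<lambda>z. (z - x0) ^ n * f z) \<in> Lp_set L p"
  by (rule Lp_set_mult_rational[OF compact_X rational_near_power _ p_nonneg])

lemma integrable_K: "f \<in> Lp_set L p \<Longrightarrow> integrable L (\<lambda>z. f z * K z)"
  by (rule integrable_pairing(1)[OF _ K_measurable K_integrable p_gt_1])

lemma integrable_weighted_K: "f \<in> Lp_set L p \<Longrightarrow> integrable L (\<lambda>z. (z - x0) ^ n * f z * K z)"
  using integrable_K[OF weighted_Lp] .

lemma K_integrable_1: "integrable L K"
  using integrable_K[OF rational_Lp[OF rational_near_const[of 1]]] by simp

text \<open>
  Equal to $F^{(m)}(x_0)/m!$ for rational $F$, and continuous in the $L^p$ norm, hence equal to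
  $D_{x_0}^m f/m!$ for $f \in R^p(X)$.
\<close>
definition taylor_coeff :: "(complex \<Rightarrow> complex) \<Rightarrow> nat \<Rightarrow> complex" where
  "taylor_coeff f m = (LINT z|L. (z - x0) ^ (t - m) * f z * K z)"

definition taylor_poly :: "(complex \<Rightarrow> complex) \<Rightarrow> complex \<Rightarrow> complex" where
  "taylor_poly f y = (\<Sum>m\<le>t. (y - x0) ^ m * taylor_coeff f m)"

text \<open>
  All moments follow from the single representation property: multiplying $F$ by a power of
  $z - x_0$ lowers the order of the derivative that is being computed. In particular one kernel
  provides the point derivations of all orders up to $t$.
\<close>
lemma weighted_moment:
  assumes "F \<in> rational_near X"
  shows "(LINT z|L. (z - x0) ^ n * F z * K z) = (if n \<le> t then (deriv ^^ (t - n)) F x0 / fact (t - n) else 0)"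
proof -
  have "(LINT z|L. (z - x0) ^ n * F z * K z) = (deriv ^^ t) (\<lambda>z. (z - x0) ^ n * F z) x0 / fact t"
    by (intro K_rep rational_near_mult rational_near_power assms)
  also have "\<dots> = (if n \<le> t then of_nat (t choose n) * fact n * (deriv ^^ (t - n)) F x0 else 0) / fact t"
    by (simp only: higher_deriv_power_mult[OF rational_near_analytic[OF assms x0_in_X]])
  also have "\<dots> = (if n \<le> t then (deriv ^^ (t - n)) F x0 / fact (t - n) else 0)"
    by (simp add: binomial_fact)
  finally show ?thesis .
qed

lemma taylor_coeff_rational:
  assumes "F \<in> rational_near X" "m \<le> t"
  shows "taylor_coeff F m = (deriv ^^ m) F x0 / fact m"
  using assms by (simp add: taylor_coeff_def weighted_moment)

lemma taylor_coeff_const: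
  assumes "m \<le> t"
  shows "taylor_coeff (\<lambda>_. c) m = (if m = 0 then c else 0)"
  using assms by (simp add: taylor_coeff_rational rational_near_const higher_deriv_const)

lemma taylor_poly_const: "taylor_poly (\<lambda>_. c) y = c"
proof -
  have "taylor_poly (\<lambda>_. c) y = (\<Sum>m\<le>t. if m = 0 then c else 0)"
    unfolding taylor_poly_def by (intro sum.cong) (auto simp: taylor_coeff_const)
  then show ?thesis by simp
qed

lemma taylor_poly_integral:
  assumes "f \<in> Lp_set L p"
  shows "taylor_poly f y = (LINT z|L. (\<Sum>m\<le>t. (y - x0) ^ m * (z - x0) ^ (t - m)) * f z * K z)"
proof -
  have "taylor_poly f y = (\<Sum>m\<le>t. LINT z|L. (y - x0) ^ m * ((z - x0) ^ (t - m) * f z * K z))"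
    unfolding taylor_poly_def taylor_coeff_def by simp
  also have "\<dots> = (LINT z|L. (\<Sum>m\<le>t. (y - x0) ^ m * ((z - x0) ^ (t - m) * f z * K z)))"
    by (intro Bochner_Integration.integral_sum[symmetric] integrable_mult_right integrable_weighted_K assms)
  finally show ?thesis by (simp add: sum_distrib_right mult.assoc)
qed

lemma power_kernel_identity:
  assumes "z \<noteq> (y::complex)"
  shows "(z - x0) ^ Suc t / (z - y) = (\<Sum>m\<le>t. (y - x0) ^ m * (z - x0) ^ (t - m)) + (y - x0) ^ Suc t / (z - y)"
proof -
  have "(z - x0) ^ Suc t - (y - x0) ^ Suc t = (z - y) * (\<Sum>m\<le>t. (y - x0) ^ m * (z - x0) ^ (t - m))"
    using diff_power_eq_sum[of "y - x0" t "z - x0"] by (simp add: lessThan_Suc_atMost algebra_simps)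
  then show ?thesis using assms by (simp add: field_simps)
qed

lemma integrable_cauchy_bounded:
  assumes F: "F \<in> rational_near X" and fin: "cauchy_potential X K y < \<infinity>"
  shows "integrable L (\<lambda>z. F z * K z / (z - y))"
proof -
  obtain B where B: "\<And>z. z \<in> X \<Longrightarrow> norm (F z) \<le> B" using rational_near_bounded compact_X F by blast
  have i: "integrable L (\<lambda>z. K z / (z - y))" by (rule integrable_cauchy_kernel[OF K_measurable fin])
  note [measurable] = rational_near_measurable[OF compact_X F] borel_measurable_integrable[OF i]
  have "integrable L (\<lambda>z. F z * (K z / (z - y)))"
  proof (rule Bochner_Integration.integrable_bound)
    show "integrable L (\<lambda>z. B * norm (K z / (z - y)))" using i by (intro integrable_mult_right integrable_norm)
    show "AE z in L. norm (F z * (K z / (z - y))) \<le> norm (B * norm (K z / (z - y)))"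
    proof (rule AE_I2)
      fix z assume "z \<in> space L"
      then have "norm (F z) * norm (K z / (z - y)) \<le> B * norm (K z / (z - y))" using B by (intro mult_right_mono) auto
      then show "norm (F z * (K z / (z - y))) \<le> norm (B * norm (K z / (z - y)))"
        unfolding norm_mult[of "F z"] using abs_ge_self order_trans real_norm_def by metis
    qed
  qed measurable
  then show ?thesis by simp
qed

text \<open>
  Integrate $(z-x_0)^{t+1} G(z)$ against $K$, where $G(z) = (F(z)-F(y))/(z-y)$. The result is $0$ by
  \<open>weighted_moment\<close>, and \<open>power_kernel_identity\<close> sorts the terms.
\<close>
lemma taylor_identity_rational:
  assumes F: "F \<in> rational_near X" and y: "y \<in> X" and fin: "cauchy_potential X K y < \<infinity>"
  shows "F y * (1 + (y - x0) ^ Suc t * cauchy_transform X K y)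
    = taylor_poly F y + (y - x0) ^ Suc t * cauchy_transform X (\<lambda>z. F z * K z) y"
proof -
  let ?u = "y - x0"
  define q where "q = (\<lambda>z. \<Sum>m\<le>t. ?u ^ m * (z - x0) ^ (t - m))"
  define D where "D = (\<lambda>z. F z + F y * (-1))"
  have D: "D \<in> rational_near X" unfolding D_def by (intro rational_near_lin F rational_near_const)
  obtain G where G: "G \<in> rational_near X" "\<And>z. z \<in> X \<Longrightarrow> (z - y) * G z = F z - F y"
    using rational_near_divided_difference[OF F y] by blast
  have iK: "integrable L (\<lambda>z. K z / (z - y))" by (rule integrable_cauchy_kernel[OF K_measurable fin])
  have iF: "integrable L (\<lambda>z. F z * K z / (z - y))" by (rule integrable_cauchy_bounded[OF F fin])
  have iq: "integrable L (\<lambda>z. q z * f z * K z)" if "f \<in> Lp_set L p" for f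
  proof -
    have "integrable L (\<lambda>z. \<Sum>m\<le>t. ?u ^ m * ((z - x0) ^ (t - m) * f z * K z))"
      by (intro Bochner_Integration.integrable_sum integrable_mult_right integrable_weighted_K that)
    then show ?thesis by (simp add: q_def sum_distrib_right mult.assoc)
  qed
  have "0 = (LINT z|L. (z - x0) ^ Suc t * G z * K z)"
    by (simp add: weighted_moment[OF G(1)] del: power_Suc)
  also have "\<dots> = (LINT z|L. (q z * F z * K z - F y * (q z * 1 * K z)) + ?u ^ Suc t * (F z * K z / (z - y) - F y * (K z / (z - y))))"
  proof (rule integral_cong_AE)
    show "(\<lambda>z. (z - x0) ^ Suc t * G z * K z) \<in> borel_measurable L"
      using integrable_weighted_K[OF rational_Lp[OF G(1)]] by (rule borel_measurable_integrable)
    show "(\<lambda>z. (q z * F z * K z - F y * (q z * 1 * K z)) + ?u ^ Suc t * (F z * K z / (z - y) - F y * (K z / (z - y)))) \<in> borel_measurable L"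
      by (rule borel_measurable_integrable) (intro Bochner_Integration.integrable_add Bochner_Integration.integrable_diff
          integrable_mult_right iK iF iq rational_Lp F rational_near_const)
    show "AE z in L. (z - x0) ^ Suc t * G z * K z
        = (q z * F z * K z - F y * (q z * 1 * K z)) + ?u ^ Suc t * (F z * K z / (z - y) - F y * (K z / (z - y)))"
      using AE_lebesgue_on_neq[OF compact_X, of y] AE_space
    proof eventually_elim
      case (elim z)
      then have "G z = (F z - F y) / (z - y)" using G(2)[of z] by (simp add: field_simps)
      then have "(z - x0) ^ Suc t * G z * K z = ((z - x0) ^ Suc t / (z - y)) * ((F z - F y) * K z)" by simp
      also have "\<dots> = (q z + ?u ^ Suc t / (z - y)) * ((F z - F y) * K z)"
        unfolding q_def by (simp only: power_kernel_identity[OF elim(1)])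
      also have "\<dots> = (q z * F z * K z - F y * (q z * 1 * K z)) + ?u ^ Suc t * (F z * K z / (z - y) - F y * (K z / (z - y)))"
        by (simp add: algebra_simps diff_divide_distrib)
      finally show ?case .
    qed
  qed
  also have "\<dots> = ((LINT z|L. q z * F z * K z) - F y * (LINT z|L. q z * 1 * K z))
      + ?u ^ Suc t * ((LINT z|L. F z * K z / (z - y)) - F y * (LINT z|L. K z / (z - y)))"
  proof -
    note i = iq[OF rational_Lp[OF F]] integrable_mult_right[OF iq[OF rational_Lp[OF rational_near_const[of 1]]], of "F y"]
      iF integrable_mult_right[OF iK, of "F y"]
    note i' = Bochner_Integration.integrable_diff[OF i(1,2)]
      integrable_mult_right[OF Bochner_Integration.integrable_diff[OF i(3,4)], of "?u ^ Suc t"]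
    show ?thesis
      by (simp only: Bochner_Integration.integral_add[OF i'] integral_mult_right_zero
          Bochner_Integration.integral_diff[OF i(1,2)] Bochner_Integration.integral_diff[OF i(3,4)])
  qed
  also have "(LINT z|L. q z * F z * K z) = taylor_poly F y"
    unfolding q_def by (rule taylor_poly_integral[OF rational_Lp[OF F], symmetric])
  also have "(LINT z|L. q z * 1 * K z) = 1"
    unfolding q_def taylor_poly_integral[OF rational_Lp[OF rational_near_const[of 1]], symmetric] by (rule taylor_poly_const)
  finally show ?thesis by (simp add: cauchy_transform_def algebra_simps)
qed

text \<open>
  The computation of \<open>taylor_identity_rational\<close> with $1/(z-y)$ in place of the divided difference.
  Hence any point at which the left-hand side is nonzero lies in $X$.
\<close>
lemma taylor_identity_off_X:
  assumes "y \<notin> X"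
  shows "1 + (y - x0) ^ Suc t * cauchy_transform X K y = 0"
proof -
  define q where "q = (\<lambda>z. \<Sum>m\<le>t. (y - x0) ^ m * (z - x0) ^ (t - m))"
  have iv: "(\<lambda>z. 1 / (z - y)) \<in> rational_near X" by (rule rational_near_inverse[OF assms])
  have iK: "integrable L (\<lambda>z. K z / (z - y))" using integrable_K[OF rational_Lp[OF iv]] by simp
  have "integrable L (\<lambda>z. \<Sum>m\<le>t. (y - x0) ^ m * ((z - x0) ^ (t - m) * 1 * K z))"
    by (intro Bochner_Integration.integrable_sum integrable_mult_right integrable_weighted_K rational_Lp rational_near_const)
  then have iq: "integrable L (\<lambda>z. q z * 1 * K z)" by (simp add: q_def sum_distrib_right mult.assoc)
  have "0 = (LINT z|L. (z - x0) ^ Suc t * (1 / (z - y)) * K z)"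
    by (simp only: weighted_moment[OF iv]) simp
  also have "\<dots> = (LINT z|L. q z * 1 * K z + (y - x0) ^ Suc t * (K z / (z - y)))"
  proof (rule Bochner_Integration.integral_cong[OF refl])
    fix z assume "z \<in> space L"
    then have "z \<noteq> y" using assms by auto
    have "(z - x0) ^ Suc t * (1 / (z - y)) * K z = ((z - x0) ^ Suc t / (z - y)) * K z" by simp
    also have "\<dots> = (q z + (y - x0) ^ Suc t / (z - y)) * K z"
      unfolding q_def by (simp only: power_kernel_identity[OF \<open>z \<noteq> y\<close>])
    finally show "(z - x0) ^ Suc t * (1 / (z - y)) * K z = q z * 1 * K z + (y - x0) ^ Suc t * (K z / (z - y))"
      by (simp only: distrib_right mult_1_right times_divide_eq_left times_divide_eq_right)
  qed
  also have "\<dots> = (LINT z|L. q z * 1 * K z) + (y - x0) ^ Suc t * (LINT z|L. K z / (z - y))"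
    by (simp only: Bochner_Integration.integral_add[OF iq integrable_mult_right[OF iK]] integral_mult_right_zero)
  also have "(LINT z|L. q z * 1 * K z) = 1"
    unfolding q_def taylor_poly_integral[OF rational_Lp[OF rational_near_const[of 1]], symmetric] by (rule taylor_poly_const)
  finally show ?thesis by (simp add: cauchy_transform_def)
qed

lemma taylor_coeff_tendsto:
  assumes F: "\<And>n. F n \<in> Lp_set L p" and f: "f \<in> Lp_set L p"
    and lim: "(\<lambda>n. pint L p (\<lambda>z. F n z - f z)) \<longlonglongrightarrow> 0"
  shows "(\<lambda>n. taylor_coeff (F n) m) \<longlonglongrightarrow> taylor_coeff f m"
proof -
  have k: "(\<lambda>z. (z - x0) ^ (t - m) * K z) \<in> borel_measurable L"
    by (intro borel_measurable_times rational_near_measurable[OF compact_X rational_near_power] K_measurable)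
  obtain B where B: "\<And>z. z \<in> X \<Longrightarrow> norm ((z - x0) ^ (t - m)) \<le> B"
    using rational_near_bounded[OF compact_X rational_near_power] by blast
  have "(\<lambda>z. K z) \<in> Lp_set L (p / (p - 1))" using K_measurable K_integrable by (simp add: Lp_set_def)
  then have "(\<lambda>z. (z - x0) ^ (t - m) * K z) \<in> Lp_set L (p / (p - 1))"
    using p_gt_1 by (intro Lp_set_mult_rational[OF compact_X rational_near_power]) auto
  then have "integrable L (\<lambda>z. norm ((z - x0) ^ (t - m) * K z) powr (p / (p - 1)))" by (rule Lp_setD(2))
  from pairing_tendsto[OF F f k this p_gt_1 lim] show ?thesis
    by (simp add: taylor_coeff_def mult_ac)
qed

end

context derivation_kernel
begin

text \<open>
  Let rational $F_n$ tend to $f$ in $L^p$ and put $d_n = F_n - f$. The defect of the identity at $y$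
  is bounded, up to a null sequence and a factor depending on $y$, by $e_n(y)$, the sum of
  $|d_n(y)|$ and the potential of $d_n K$ at $y$. The integral of $e_n$ over $X$ tends to $0$, so
  $\liminf_n e_n = 0$ almost everywhere by Fatou's lemma, and no subsequence has to be chosen.
\<close>
lemma taylor_identity_AE:
  assumes F: "\<And>n. F n \<in> rational_near X" and f: "f \<in> Lp_set L p"
    and lim: "(\<lambda>n. pint L p (\<lambda>z. F n z - f z)) \<longlonglongrightarrow> 0"
  shows "AE y in L. cauchy_potential X K y < \<infinity> \<longrightarrow> cauchy_potential X (\<lambda>z. f z * K z) y < \<infinity> \<longrightarrow>
    f y * (1 + (y - x0) ^ Suc t * cauchy_transform X K y)
      = taylor_poly f y + (y - x0) ^ Suc t * cauchy_transform X (\<lambda>z. f z * K z) y"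
proof -
  define d where "d = (\<lambda>n z. F n z - f z)"
  define e where "e = (\<lambda>n y. ennreal (norm (d n y)) + cauchy_potential X (\<lambda>z. d n z * K z) y)"
  have dLp: "d n \<in> Lp_set L p" for n
    unfolding d_def by (intro Lp_set_diff rational_Lp F f p_nonneg)
  have dK: "integrable L (\<lambda>z. d n z * K z)" for n by (rule integrable_K[OF dLp])
  obtain R where R: "R > 0" "X \<subseteq> ball x0 R"
    using bounded_subset_ballD[OF compact_imp_bounded[OF compact_X]] by blast
  have pot_m: "cauchy_potential X (\<lambda>z. d n z * K z) \<in> borel_measurable L" for n
    using cauchy_potential_measurable[OF compact_X borel_measurable_integrable[OF dK]]
    by (intro measurable_restrict_space1 measurable_completion) simp
  have norm_m: "(\<lambda>y. ennreal (norm (d n y))) \<in> borel_measurable L" for n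
    by (intro measurable_compose[OF _ measurable_ennreal] measurable_compose[OF Lp_setD(1)[OF dLp] borel_measurable_norm])
  have e_m: "e n \<in> borel_measurable L" for n
    unfolding e_def by (intro borel_measurable_add pot_m norm_m)
  have pd: "(\<lambda>n. pint L p (d n)) \<longlonglongrightarrow> 0" using lim by (simp add: d_def)
  have one: "(\<lambda>_. 1 :: complex) \<in> borel_measurable L" "integrable L (\<lambda>z. norm (1 :: complex) powr (p / (p - 1)))"
    using finite_measure_lebesgue_on_compact[OF compact_X] by (auto intro: finite_measure.integrable_const)
  have "integrable L (\<lambda>z. norm (d n z))" for n
    using integrable_norm[OF integrable_pairing(1)[OF dLp one p_gt_1]] by simp
  then have int_e: "(\<integral>\<^sup>+ y. e n y \<partial>L) \<le> ennreal ((LINT z|L. norm (d n z)) + 5 * unit_disc_area * R * (LINT z|L. norm (d n z * K z)))" for n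
  proof -
    have "(\<integral>\<^sup>+ y. e n y \<partial>L) = (\<integral>\<^sup>+ y. ennreal (norm (d n y)) \<partial>L) + (\<integral>\<^sup>+ y. cauchy_potential X (\<lambda>z. d n z * K z) y \<partial>L)"
      unfolding e_def by (intro nn_integral_add pot_m norm_m)
    also have "(\<integral>\<^sup>+ y. ennreal (norm (d n y)) \<partial>L) = ennreal (LINT z|L. norm (d n z))"
      using \<open>integrable L (\<lambda>z. norm (d n z))\<close> by (intro nn_integral_eq_integral) auto
    also have "(\<integral>\<^sup>+ y. cauchy_potential X (\<lambda>z. d n z * K z) y \<partial>L) \<le> ennreal (5 * unit_disc_area * R * (LINT z|L. norm (d n z * K z)))"
      using nn_integral_lebesgue_on_le_ball[OF compact_X R(2)] cauchy_potential_integral_le[OF compact_X dK R(1)]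
      by (rule order_trans)
    finally show ?thesis using R(1) by (simp add: ennreal_plus[symmetric] del: ennreal_plus)
  qed
  have "(\<lambda>n. LINT z|L. norm (d n z)) \<longlonglongrightarrow> 0"
    using pairing_tendsto_zero[OF dLp one p_gt_1 pd] by simp
  moreover have "(\<lambda>n. LINT z|L. norm (d n z * K z)) \<longlonglongrightarrow> 0"
    using pairing_tendsto_zero[OF dLp K_measurable K_integrable p_gt_1 pd] by (simp add: norm_mult)
  ultimately have "(\<lambda>n. (LINT z|L. norm (d n z)) + 5 * unit_disc_area * R * (LINT z|L. norm (d n z * K z))) \<longlonglongrightarrow> 0 + 5 * unit_disc_area * R * 0"
    by (intro tendsto_intros)
  then have "(\<lambda>n. ennreal ((LINT z|L. norm (d n z)) + 5 * unit_disc_area * R * (LINT z|L. norm (d n z * K z)))) \<longlonglongrightarrow> ennreal 0"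
    by (intro tendsto_ennrealI) simp
  then have "(\<lambda>n. \<integral>\<^sup>+ y. e n y \<partial>L) \<longlonglongrightarrow> 0"
    by (intro tendsto_sandwich[OF _ _ tendsto_const, of 0 "\<lambda>n. \<integral>\<^sup>+ y. e n y \<partial>L"]) (auto simp: int_e)
  then have "liminf (\<lambda>n. \<integral>\<^sup>+ y. e n y \<partial>L) = 0" by (rule lim_imp_Liminf[OF sequentially_bot])
  moreover have "(\<integral>\<^sup>+ y. liminf (\<lambda>n. e n y) \<partial>L) \<le> liminf (\<lambda>n. \<integral>\<^sup>+ y. e n y \<partial>L)"
    by (rule nn_integral_liminf[OF e_m])
  ultimately have "(\<integral>\<^sup>+ y. liminf (\<lambda>n. e n y) \<partial>L) = 0" by simp
  moreover have "(\<lambda>y. liminf (\<lambda>n. e n y)) \<in> borel_measurable L" by (intro borel_measurable_liminf e_m)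
  ultimately have "AE y in L. liminf (\<lambda>n. e n y) = 0" by (simp add: nn_integral_0_iff_AE)
  then show ?thesis
    using AE_space
  proof eventually_elim
    case (elim y)
    then have y: "y \<in> X" by simp
    show ?case
    proof (intro impI)
      assume finK: "cauchy_potential X K y < \<infinity>" and finf: "cauchy_potential X (\<lambda>z. f z * K z) y < \<infinity>"
      define a where "a = 1 + (y - x0) ^ Suc t * cauchy_transform X K y"
      define b where "b = (y - x0) ^ Suc t"
      define D where "D = f y * a - taylor_poly f y - b * cauchy_transform X (\<lambda>z. f z * K z) y"
      define A where "A = norm a + norm b + 1"
      have A: "A > 0" by (simp add: A_def add_pos_nonneg add_nonneg_pos)
      have bound: "norm D \<le> norm a * norm (d n y) + norm (taylor_poly (F n) y - taylor_poly f y)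
          + norm b * norm (cauchy_transform X (\<lambda>z. d n z * K z) y)" for n
      proof -
        have "cauchy_transform X (\<lambda>z. d n z * K z) y = (LINT z|L. F n z * K z / (z - y) - f z * K z / (z - y))"
          unfolding cauchy_transform_def d_def by (simp add: left_diff_distrib diff_divide_distrib)
        also have "\<dots> = cauchy_transform X (\<lambda>z. F n z * K z) y - cauchy_transform X (\<lambda>z. f z * K z) y"
          unfolding cauchy_transform_def
          by (intro Bochner_Integration.integral_diff integrable_cauchy_bounded[OF F finK]
              integrable_cauchy_kernel[OF borel_measurable_integrable[OF integrable_K[OF f]] finf])
        finally have ct: "cauchy_transform X (\<lambda>z. d n z * K z) y
            = cauchy_transform X (\<lambda>z. F n z * K z) y - cauchy_transform X (\<lambda>z. f z * K z) y" .
        have "F n y * a = taylor_poly (F n) y + b * cauchy_transform X (\<lambda>z. F n z * K z) y"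
          unfolding a_def b_def by (rule taylor_identity_rational[OF F y finK])
        then have "D = - (a * d n y) + (taylor_poly (F n) y - taylor_poly f y) + b * cauchy_transform X (\<lambda>z. d n z * K z) y"
          unfolding D_def ct by (simp add: d_def algebra_simps)
        also have "norm \<dots> \<le> norm (- (a * d n y)) + norm (taylor_poly (F n) y - taylor_poly f y) + norm (b * cauchy_transform X (\<lambda>z. d n z * K z) y)"
          by (intro norm_triangle_le add_mono norm_triangle_ineq order_refl)
        finally show ?thesis by (simp add: norm_mult)
      qed
      have "D = 0"
      proof (rule ccontr)
        assume "D \<noteq> 0"
        \<comment> \<open>If $e_n(y) < c$, the two terms controlled by $e_n(y)$ account for at most half of
          $|D|$, and the third one is eventually below the other half.\<close>
        define c where "c = norm D / (2 * A)"
        have c: "c > 0" using A \<open>D \<noteq> 0\<close> by (simp add: c_def)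
        have "(\<lambda>n. taylor_poly (F n) y - taylor_poly f y) \<longlonglongrightarrow> taylor_poly f y - taylor_poly f y"
          unfolding taylor_poly_def by (intro tendsto_intros taylor_coeff_tendsto rational_Lp F f lim)
        then have "(\<lambda>n. norm (taylor_poly (F n) y - taylor_poly f y)) \<longlonglongrightarrow> 0"
          by (intro tendsto_norm_zero) simp
        then have "\<forall>\<^sub>F n in sequentially. norm (taylor_poly (F n) y - taylor_poly f y) < norm D / 2"
          using \<open>D \<noteq> 0\<close> by (intro order_tendstoD(2)) auto
        then have "\<forall>\<^sub>F n in sequentially. ennreal c \<le> e n y"
        proof eventually_elim
          case (elim n)
          show ?case
          proof (rule ccontr)
            assume "\<not> ennreal c \<le> e n y"
            then have "e n y < ennreal c" by simp
            moreover have "ennreal (norm (d n y)) \<le> e n y" "cauchy_potential X (\<lambda>z. d n z * K z) y \<le> e n y"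
              unfolding e_def by (auto intro: add_increasing add_increasing2)
            ultimately have "ennreal (norm (d n y)) < ennreal c"
              "cauchy_potential X (\<lambda>z. d n z * K z) y < ennreal c"
              by (blast intro: le_less_trans)+
            then have "norm (d n y) < c" "norm (cauchy_transform X (\<lambda>z. d n z * K z) y) < c"
              using norm_cauchy_transform_le[of X "\<lambda>z. d n z * K z" y] c
              by (auto simp: ennreal_less_iff dest: le_less_trans)
            then have "norm a * norm (d n y) + norm b * norm (cauchy_transform X (\<lambda>z. d n z * K z) y) \<le> norm a * c + norm b * c"
              by (intro add_mono mult_left_mono) auto
            also have "\<dots> \<le> A * c" using c by (simp add: A_def distrib_right)
            also have "\<dots> = norm D / 2" using A by (simp add: c_def)
            finally show False using bound[of n] elim by linarith
          qed
        qed
        then have "ennreal c \<le> liminf (\<lambda>n. e n y)" by (rule Liminf_bounded)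
        then show False using elim(1) c by simp
      qed
      then show "f y * (1 + (y - x0) ^ Suc t * cauchy_transform X K y)
          = taylor_poly f y + (y - x0) ^ Suc t * cauchy_transform X (\<lambda>z. f z * K z) y"
        by (simp add: D_def a_def b_def algebra_simps)
    qed
  qed
qed

text \<open>
  On the sublevel sets $A_n$ both $|u|\,|\widehat K(y)|$ and $|u|\,|\widehat{fK}(y)|$ are at most
  $1/(n+2)$. Within distance $1$ of $x_0$ this keeps $1 + u^{t+1} \widehat K(y)$ at least $1/2$ in
  absolute value, so $y$ lies in $X$, and dividing the Taylor identity by this number gives the
  expansion.
\<close>
theorem approximate_taylor_expansion:
  assumes F: "\<And>n. F n \<in> rational_near X" and f: "f \<in> Lp_set L p"
    and lim: "(\<lambda>n. pint L p (\<lambda>z. F n z - f z)) \<longlonglongrightarrow> 0"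
  obtains E where "density_point E x0" "E \<subseteq> X" "x0 \<notin> E"
    "\<And>\<epsilon>. \<epsilon> > 0 \<Longrightarrow> \<exists>r>0. \<forall>y \<in> E \<inter> ball x0 r. norm (f y - taylor_poly f y) \<le> \<epsilon> * norm (y - x0) ^ t"
proof -
  let ?fK = "\<lambda>z. f z * K z"
  have fK: "integrable L ?fK" by (rule integrable_K[OF f])
  obtain N where N: "N \<in> null_sets lebesgue" and identity:
    "\<And>y. y \<in> X \<Longrightarrow> y \<notin> N \<Longrightarrow> cauchy_potential X K y < \<infinity> \<Longrightarrow> cauchy_potential X ?fK y < \<infinity> \<Longrightarrow>
      f y * (1 + (y - x0) ^ Suc t * cauchy_transform X K y) = taylor_poly f y + (y - x0) ^ Suc t * cauchy_transform X ?fK y"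
  proof -
    have "AE y in lebesgue. y \<in> X \<longrightarrow> cauchy_potential X K y < \<infinity> \<longrightarrow> cauchy_potential X ?fK y < \<infinity> \<longrightarrow>
      f y * (1 + (y - x0) ^ Suc t * cauchy_transform X K y) = taylor_poly f y + (y - x0) ^ Suc t * cauchy_transform X ?fK y" (is "AE y in lebesgue. ?P y")
    proof -
      have X: "X \<inter> space lebesgue \<in> sets lebesgue" using fmeasurableD[OF lmeasurable_compact[OF compact_X]] by simp
      show ?thesis using taylor_identity_AE[OF F f lim] unfolding AE_restrict_space_iff[OF X] .
    qed
    then obtain N where "N \<in> null_sets lebesgue" "{y \<in> space lebesgue. \<not> ?P y} \<subseteq> N"
      unfolding eventually_ae_filter by blast
    then show ?thesis by (intro that[of N]) auto
  qed
  define u where "u = (\<lambda>H y. ennreal (norm (y - x0)) * cauchy_potential X H y)"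
  define A where "A = (\<lambda>n. {y. u K y \<le> ennreal (1 / real (n + 2))} \<inter> {y. u ?fK y \<le> ennreal (1 / real (n + 2))})"
  have sub: "density_point {y. u H y \<le> ennreal c} x0" if H: "integrable L H" and c: "c > 0" for H c
  proof (rule density_point_sublevel)
    have "(\<lambda>y::complex. ennreal (norm (y - x0))) \<in> borel_measurable lborel" by measurable
    then show "u H \<in> borel_measurable lborel"
      unfolding u_def by (intro borel_measurable_times_ennreal cauchy_potential_measurable[OF compact_X borel_measurable_integrable[OF H]])
    show "((\<lambda>r. ennreal (1 / r^2) * (\<integral>\<^sup>+ y. u H y * indicator (ball x0 r) y \<partial>lborel)) \<longlongrightarrow> 0) (at_right 0)"
      unfolding u_def by (rule cauchy_potential_average_tendsto_0[OF compact_X H])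
  qed fact
  have A: "density_point (A n) x0" for n
    unfolding A_def by (intro density_point_Int sub K_integrable_1 fK) auto
  obtain E where E: "density_point E x0" "\<And>n. \<exists>r>0. E \<inter> ball x0 r \<subseteq> A n"
    by (rule density_point_diagonal[OF A]) (rule that)
  obtain r0 where r0: "r0 > 0" "E \<inter> ball x0 r0 \<subseteq> A 0" using E(2) by blast
  define \<rho> where "\<rho> = min r0 1"
  have \<rho>: "\<rho> > 0" "\<rho> \<le> r0" "\<rho> \<le> 1" using r0 by (auto simp: \<rho>_def)
  define E' where "E' = (E \<inter> ball x0 \<rho>) - (insert x0 N)"
  have ball: "density_point (ball x0 \<rho>) x0"
    unfolding density_point_def
  proof
    have "\<forall>\<^sub>F r in at_right 0. measure lebesgue (ball x0 r - ball x0 \<rho>) / r^2 = 0"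
    proof (rule eventually_at_rightI[of 0 \<rho>])
      fix r assume "r \<in> {0<..<\<rho>}"
      then have "ball x0 r - ball x0 \<rho> = {}" by auto
      then show "measure lebesgue (ball x0 r - ball x0 \<rho>) / r^2 = 0" by (simp only: measure_empty div_0)
    qed (use \<rho> in auto)
    then show "((\<lambda>r. measure lebesgue (ball x0 r - ball x0 \<rho>) / r^2) \<longlongrightarrow> 0) (at_right 0)"
      by (rule tendsto_eventually)
  qed auto
  have E'_density: "density_point E' x0"
    unfolding E'_def using N by (intro density_point_minus_null density_point_Int E(1) ball) auto
  have half: "norm (1 + (y - x0) ^ Suc t * cauchy_transform X K y) \<ge> 1/2"
    and fin: "cauchy_potential X K y < \<infinity>" "cauchy_potential X ?fK y < \<infinity>"
    and tr: "norm ((y - x0) ^ Suc t * cauchy_transform X K y) \<le> norm (y - x0) ^ t * c"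
      "norm ((y - x0) ^ Suc t * cauchy_transform X ?fK y) \<le> norm (y - x0) ^ t * c"
    if y: "y \<in> E'" and yA: "y \<in> A n" and c: "c = 1 / real (n + 2)" for y n c
  proof -
    have y': "y \<noteq> x0" "norm (y - x0) \<le> 1" "c > 0"
      using y \<rho> c by (auto simp: E'_def dist_norm norm_minus_commute)
    have le: "u K y \<le> ennreal c" "u ?fK y \<le> ennreal c" using yA c by (auto simp: A_def)
    have fin': "cauchy_potential X H y < \<infinity>" if "u H y \<le> ennreal c" for H
    proof (rule ccontr)
      assume "\<not> cauchy_potential X H y < \<infinity>"
      then have "cauchy_potential X H y = \<infinity>" using top.not_eq_extremum[of "cauchy_potential X H y"] by auto
      then have "u H y = \<infinity>" using y'(1) by (simp add: u_def ennreal_mult_eq_top_iff)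
      then show False using that by (simp add: top_unique)
    qed
    from fin'[OF le(1)] fin'[OF le(2)] show "cauchy_potential X K y < \<infinity>" "cauchy_potential X ?fK y < \<infinity>" .
    have tr': "norm ((y - x0) ^ Suc t * cauchy_transform X H y) \<le> norm (y - x0) ^ t * c" if "u H y \<le> ennreal c" for H
    proof -
      have "ennreal (norm (y - x0) * norm (cauchy_transform X H y)) \<le> u H y"
        unfolding u_def ennreal_mult[OF norm_ge_zero norm_ge_zero] by (intro mult_left_mono norm_cauchy_transform_le) simp
      also note that
      finally have "norm (y - x0) * norm (cauchy_transform X H y) \<le> c" using y'(3) by (simp add: ennreal_le_iff)
      then have "norm (y - x0) ^ t * (norm (y - x0) * norm (cauchy_transform X H y)) \<le> norm (y - x0) ^ t * c"
        by (intro mult_left_mono) auto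
      then show ?thesis by (simp add: norm_mult norm_power mult_ac)
    qed
    from tr'[OF le(1)] tr'[OF le(2)] show "norm ((y - x0) ^ Suc t * cauchy_transform X K y) \<le> norm (y - x0) ^ t * c"
      "norm ((y - x0) ^ Suc t * cauchy_transform X ?fK y) \<le> norm (y - x0) ^ t * c" .
    have "norm (y - x0) ^ t * c \<le> 1 * (1/2)"
      using y'(2) c by (intro mult_mono power_le_one) auto
    with tr'[OF le(1)] have "norm ((y - x0) ^ Suc t * cauchy_transform X K y) \<le> 1/2" by linarith
    then show "norm (1 + (y - x0) ^ Suc t * cauchy_transform X K y) \<ge> 1/2"
      using norm_triangle_ineq2[of 1 "- ((y - x0) ^ Suc t * cauchy_transform X K y)"] by (simp del: power_Suc)
  qed
  have E'A: "y \<in> A 0" if "y \<in> E'" for y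
    using that r0(2) \<rho>(2) by (auto simp: E'_def)
  have E'X: "E' \<subseteq> X"
  proof
    fix y assume y: "y \<in> E'"
    show "y \<in> X"
    proof (rule ccontr)
      assume "y \<notin> X"
      then show False using half[OF y E'A[OF y] refl] taylor_identity_off_X[of y] by (simp del: power_Suc)
    qed
  qed
  show ?thesis
  proof (rule that[OF E'_density E'X])
    show "x0 \<notin> E'" by (simp add: E'_def)
    fix \<epsilon> :: real assume \<epsilon>: "\<epsilon> > 0"
    define B where "B = (\<Sum>m\<le>t. norm (taylor_coeff f m))"
    have B: "B \<ge> 0" by (simp add: B_def sum_nonneg)
    obtain n where n: "2 * (1 + B) / \<epsilon> < real n" using reals_Archimedean2 by blast
    define c where "c = 1 / real (n + 2)"
    have "2 * (1 + B) / \<epsilon> < real (n + 2)" using n by simp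
    then have c: "c > 0" "2 * (1 + B) * c \<le> \<epsilon>" using \<epsilon> by (auto simp: c_def field_simps)
    obtain r where r: "r > 0" "E \<inter> ball x0 r \<subseteq> A n" using E(2) by blast
    have "norm (f y - taylor_poly f y) \<le> \<epsilon> * norm (y - x0) ^ t" if y: "y \<in> E' \<inter> ball x0 r" for y
    proof -
      have yE: "y \<in> E'" and yA: "y \<in> A n" using y r(2) by (auto simp: E'_def)
      have yN: "y \<notin> N" "norm (y - x0) \<le> 1" using yE \<rho> by (auto simp: E'_def dist_norm norm_minus_commute)
      define \<alpha> where "\<alpha> = (y - x0) ^ Suc t * cauchy_transform X K y"
      define \<beta> where "\<beta> = (y - x0) ^ Suc t * cauchy_transform X ?fK y"
      have \<alpha>: "norm \<alpha> \<le> norm (y - x0) ^ t * c" and \<beta>: "norm \<beta> \<le> norm (y - x0) ^ t * c" and h: "1/2 \<le> norm (1 + \<alpha>)"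
        unfolding \<alpha>_def \<beta>_def by (rule tr[OF yE yA c_def] half[OF yE yA c_def])+
      have "f y * (1 + \<alpha>) = taylor_poly f y + \<beta>"
        unfolding \<alpha>_def \<beta>_def using E'X yE yN fin[OF yE yA c_def] by (intro identity) auto
      then have eq: "(f y - taylor_poly f y) * (1 + \<alpha>) = \<beta> - \<alpha> * taylor_poly f y"
        by (simp add: algebra_simps)
      have "norm (taylor_poly f y) \<le> (\<Sum>m\<le>t. norm ((y - x0) ^ m * taylor_coeff f m))"
        unfolding taylor_poly_def by (rule norm_sum)
      also have "\<dots> \<le> B"
        unfolding B_def using yN(2) by (intro sum_mono) (auto simp: norm_mult norm_power power_le_one mult_left_le_one_le)
      finally have P: "norm (taylor_poly f y) \<le> B" .
      have "norm (f y - taylor_poly f y) * (1/2) \<le> norm (f y - taylor_poly f y) * norm (1 + \<alpha>)"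
        using h by (intro mult_left_mono) auto
      also have "\<dots> = norm (\<beta> - \<alpha> * taylor_poly f y)" by (simp only: norm_mult[symmetric] eq)
      also have "\<dots> \<le> norm \<beta> + norm \<alpha> * norm (taylor_poly f y)"
        using norm_triangle_ineq4[of \<beta> "\<alpha> * taylor_poly f y"] by (simp add: norm_mult)
      also have "\<dots> \<le> norm (y - x0) ^ t * c + norm (y - x0) ^ t * c * B"
        using \<alpha> \<beta> P c B by (intro add_mono mult_mono) auto
      finally have "norm (f y - taylor_poly f y) \<le> norm (y - x0) ^ t * (2 * (1 + B) * c)" by (simp add: algebra_simps)
      also have "\<dots> \<le> norm (y - x0) ^ t * \<epsilon>" by (intro mult_left_mono c) auto
      finally show ?thesis by (simp add: mult.commute)
    qed
    then show "\<exists>r>0. \<forall>y \<in> E' \<inter> ball x0 r. norm (f y - taylor_poly f y) \<le> \<epsilon> * norm (y - x0) ^ t"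
      using r(1) by blast
  qed
qed

lemma Lp_norm_tendsto_imp_pint_tendsto:
  assumes "(\<lambda>j. Lp_norm X p (g j)) \<longlonglongrightarrow> 0"
  shows "(\<lambda>j. pint L p (g j)) \<longlonglongrightarrow> 0"
proof -
  have "pint L p (g j) = Lp_norm X p (g j) powr p" for j
    using p_gt_1 pint_nonneg[of L p "g j"] by (simp add: Lp_norm_def pint_def powr_powr)
  moreover have "(\<lambda>j. Lp_norm X p (g j) powr p) \<longlonglongrightarrow> 0 powr p"
    using assms p_gt_1 by (intro tendsto_powr' tendsto_const) (auto simp: Lp_norm_def)
  ultimately show ?thesis by simp
qed

lemma Rp_in_Lp: "f \<in> Rp X p \<Longrightarrow> f \<in> Lp_set L p"
  by (simp add: Rp_def Lp_fun_def Lp_set_def)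

lemma Rp_approximating_sequence:
  assumes "f \<in> Rp X p"
  obtains F where "\<And>j. F j \<in> rational_off X" "(\<lambda>j. Lp_norm X p (\<lambda>z. F j z - f z)) \<longlonglongrightarrow> 0"
proof -
  have "\<forall>j. \<exists>F\<in>rational_off X. Lp_norm X p (\<lambda>z. F z - f z) < 1 / real (Suc j)"
    using assms by (simp add: Rp_def)
  then obtain F where F: "\<And>j. F j \<in> rational_off X" "\<And>j. Lp_norm X p (\<lambda>z. F j z - f z) < 1 / real (Suc j)"
    by metis
  have "(\<lambda>j. Lp_norm X p (\<lambda>z. F j z - f z)) \<longlonglongrightarrow> 0"
  proof (rule tendsto_sandwich[OF _ _ tendsto_const])
    show "(\<lambda>j. 1 / real (Suc j)) \<longlonglongrightarrow> 0" using LIMSEQ_inverse_real_of_nat by (simp add: inverse_eq_divide)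
    show "\<forall>\<^sub>F j in sequentially. Lp_norm X p (\<lambda>z. F j z - f z) \<le> 1 / real (Suc j)"
      by (intro always_eventually allI less_imp_le F(2))
  qed (simp add: Lp_norm_def)
  with F(1) show ?thesis by (rule that)
qed

lemma point_derivation_eq:
  assumes f: "f \<in> Rp X p" and m: "m \<le> t"
  shows "point_derivation X p m x0 f = fact m * taylor_coeff f m"
proof -
  have lim: "(\<lambda>j. (deriv ^^ m) (F j) x0) \<longlonglongrightarrow> fact m * taylor_coeff f m"
    if F: "\<And>j. F j \<in> rational_off X" and l: "(\<lambda>j. Lp_norm X p (\<lambda>z. F j z - f z)) \<longlonglongrightarrow> 0" for F
  proof -
    have Fn: "F j \<in> rational_near X" for j using F rational_off_subset by blast
    have "(\<lambda>j. fact m * taylor_coeff (F j) m) \<longlonglongrightarrow> fact m * taylor_coeff f m"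
      by (intro tendsto_intros taylor_coeff_tendsto rational_Lp Fn Rp_in_Lp f Lp_norm_tendsto_imp_pint_tendsto l)
    then show ?thesis using m by (simp add: taylor_coeff_rational[OF Fn])
  qed
  obtain F where F: "\<And>j. F j \<in> rational_off X" "(\<lambda>j. Lp_norm X p (\<lambda>z. F j z - f z)) \<longlonglongrightarrow> 0"
    using Rp_approximating_sequence[OF f] by blast
  show ?thesis
    unfolding point_derivation_def
  proof (rule the_equality)
    show "\<forall>F. (\<forall>j. F j \<in> rational_off X) \<longrightarrow> (\<lambda>j. Lp_norm X p (\<lambda>z. F j z - f z)) \<longlonglongrightarrow> 0 \<longrightarrow>
      (\<lambda>j. (deriv ^^ m) (F j) x0) \<longlonglongrightarrow> fact m * taylor_coeff f m"
      using lim by blast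
    fix l
    assume "\<forall>F. (\<forall>j. F j \<in> rational_off X) \<longrightarrow> (\<lambda>j. Lp_norm X p (\<lambda>z. F j z - f z)) \<longlonglongrightarrow> 0 \<longrightarrow>
      (\<lambda>j. (deriv ^^ m) (F j) x0) \<longlonglongrightarrow> l"
    then have "(\<lambda>j. (deriv ^^ m) (F j) x0) \<longlonglongrightarrow> l" using F by blast
    then show "l = fact m * taylor_coeff f m" using lim[OF F] LIMSEQ_unique by blast
  qed
qed

theorem Rp_approximate_taylor_expansion:
  assumes "f \<in> Rp X p"
  obtains E where "density_point E x0" "E \<subseteq> X" "x0 \<notin> E"
    "\<And>\<epsilon>. \<epsilon> > 0 \<Longrightarrow> \<exists>r>0. \<forall>y \<in> E \<inter> ball x0 r. norm (f y - taylor_poly f y) \<le> \<epsilon> * norm (y - x0) ^ t"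
proof -
  obtain F where F: "\<And>j. F j \<in> rational_off X" "(\<lambda>j. Lp_norm X p (\<lambda>z. F j z - f z)) \<longlonglongrightarrow> 0"
    using Rp_approximating_sequence[OF assms] by blast
  have "F j \<in> rational_near X" for j using F(1) rational_off_subset by blast
  from approximate_taylor_expansion[OF this Rp_in_Lp[OF assms] Lp_norm_tendsto_imp_pint_tendsto[OF F(2)]]
  show ?thesis using that by blast
qed

end

section \<open>Difference quotients\<close>

text \<open>
  The difference of order $t+1$ is the difference of order $t$ of the forward difference.
\<close>
lemma alternating_binomial_sum_Suc:
  fixes g :: "nat \<Rightarrow> 'a::comm_ring_1"
  shows "(\<Sum>s\<le>Suc t. (-1) ^ (Suc t - s) * of_nat (Suc t choose s) * g s)
    = (\<Sum>s\<le>t. (-1) ^ (t - s) * of_nat (t choose s) * (g (Suc s) - g s))"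
proof -
  have shift: "(\<Sum>s\<le>t. (-1) ^ (t - s) * of_nat (t choose s) * g s)
      = (-1) ^ t * g 0 - (\<Sum>s\<le>t. (-1) ^ (t - s) * of_nat (t choose Suc s) * g (Suc s))"
  proof (cases t)
    case (Suc n)
    have "(\<Sum>s\<le>n. (-1) ^ (n - s) * of_nat (t choose Suc s) * g (Suc s))
        = - (\<Sum>s\<le>n. (-1) ^ (t - s) * of_nat (t choose Suc s) * g (Suc s))"
      unfolding sum_negf[symmetric] by (intro sum.cong refl) (simp add: Suc Suc_diff_le)
    then show ?thesis
      unfolding Suc by (subst sum.atMost_Suc_shift) (simp add: Suc binomial_eq_0)
  qed simp
  have "(\<Sum>s\<le>Suc t. (-1) ^ (Suc t - s) * of_nat (Suc t choose s) * g s)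
      = (-1) ^ Suc t * g 0 + (\<Sum>s\<le>t. (-1) ^ (t - s) * of_nat ((t choose s) + (t choose Suc s)) * g (Suc s))"
    by (subst sum.atMost_Suc_shift) simp
  also have "\<dots> = (\<Sum>s\<le>t. (-1) ^ (t - s) * of_nat (t choose s) * g (Suc s))
      - ((-1) ^ t * g 0 - (\<Sum>s\<le>t. (-1) ^ (t - s) * of_nat (t choose Suc s) * g (Suc s)))"
    by (simp add: algebra_simps sum.distrib)
  also have "\<dots> = (\<Sum>s\<le>t. (-1) ^ (t - s) * of_nat (t choose s) * (g (Suc s) - g s))"
    unfolding shift[symmetric] by (simp add: right_diff_distrib sum_subtractf)
  finally show ?thesis .
qed

text \<open>
  Each forward difference lowers the degree by one, so $t$ of them annihilate $s^m$ for $m < t$ and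
  turn $s^t$ into $t!$.
\<close>
lemma alternating_binomial_sum_power:
  assumes "m \<le> t"
  shows "(\<Sum>s\<le>t. (-1) ^ (t - s) * of_nat (t choose s) * of_nat s ^ m) = (if m = t then fact t else 0 :: 'a::{comm_ring_1, ring_char_0})"
  using assms
proof (induction t arbitrary: m)
  case 0
  then show ?case by simp
next
  case (Suc t)
  have diff: "of_nat (Suc s) ^ m - of_nat s ^ m = (\<Sum>i<m. of_nat (m choose i) * of_nat s ^ i :: 'a)" for s
  proof -
    have "of_nat (Suc s) ^ m = (of_nat s + 1 :: 'a) ^ m" by (simp add: add.commute)
    also have "\<dots> = (\<Sum>i\<le>m. of_nat (m choose i) * of_nat s ^ i)"
      by (simp add: binomial_ring)
    also have "\<dots> = (\<Sum>i<m. of_nat (m choose i) * of_nat s ^ i) + of_nat s ^ m"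
      by (simp add: lessThan_Suc_atMost[symmetric])
    finally show ?thesis by simp
  qed
  have "(\<Sum>s\<le>Suc t. (-1) ^ (Suc t - s) * of_nat (Suc t choose s) * of_nat s ^ m)
      = (\<Sum>s\<le>t. (-1) ^ (t - s) * of_nat (t choose s) * (\<Sum>i<m. of_nat (m choose i) * of_nat s ^ i) :: 'a)"
    unfolding alternating_binomial_sum_Suc diff ..
  also have "\<dots> = (\<Sum>i<m. of_nat (m choose i) * (\<Sum>s\<le>t. (-1) ^ (t - s) * of_nat (t choose s) * of_nat s ^ i))"
    unfolding sum_distrib_left by (subst sum.swap) (simp add: mult_ac)
  also have "\<dots> = (\<Sum>i<m. of_nat (m choose i) * (if i = t then fact t else 0))"
    using Suc.prems by (intro sum.cong refl arg_cong2[where f = "(*)"] Suc.IH) auto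
  also have "\<dots> = (\<Sum>i<m. if i = t then of_nat (m choose t) * fact t else 0)"
    by (intro sum.cong refl) auto
  also have "\<dots> = (if t < m then of_nat (m choose t) * fact t else 0)"
    by simp
  also have "\<dots> = (if m = Suc t then fact (Suc t) else 0)"
    using Suc.prems by auto
  finally show ?case .
qed

lemma diff_quotient_polynomial:
  assumes "h \<noteq> 0"
  shows "diff_quotient t h (\<lambda>y. \<Sum>m\<le>t. (y - x0) ^ m * c m) x0 = fact t * c t"
proof -
  have "(\<Sum>s=0..t. (-1) ^ (t - s) * of_nat (t choose s) * (\<Sum>m\<le>t. (x0 + of_nat s * h - x0) ^ m * c m))
      = (\<Sum>s\<le>t. \<Sum>m\<le>t. h ^ m * c m * ((-1) ^ (t - s) * of_nat (t choose s) * of_nat s ^ m))"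
    by (simp add: atLeast0AtMost sum_distrib_left power_mult_distrib mult_ac)
  also have "\<dots> = (\<Sum>m\<le>t. h ^ m * c m * (\<Sum>s\<le>t. (-1) ^ (t - s) * of_nat (t choose s) * of_nat s ^ m))"
    by (subst sum.swap) (simp add: sum_distrib_left)
  also have "\<dots> = (\<Sum>m\<le>t. if m = t then h ^ t * c t * fact t else 0)"
    by (intro sum.cong refl) (auto simp: alternating_binomial_sum_power)
  also have "\<dots> = h ^ t * (fact t * c t)" by simp
  finally show ?thesis using assms by (simp add: diff_quotient_def)
qed

lemma diff_quotient_diff:
  "diff_quotient t h f x0 - diff_quotient t h g x0 = diff_quotient t h (\<lambda>y. f y - g y) x0"
  by (simp add: diff_quotient_def right_diff_distrib sum_subtractf)

lemma norm_diff_quotient_le: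
  assumes "h \<noteq> 0" "0 \<le> \<epsilon>" and le: "\<And>s. s \<le> t \<Longrightarrow> norm (g (x0 + of_nat s * h)) \<le> \<epsilon> * norm (of_nat s * h) ^ t"
  shows "norm (diff_quotient t h g x0) \<le> \<epsilon> * (\<Sum>s=0..t. real (t choose s) * real s ^ t)"
proof -
  have "norm (\<Sum>s=0..t. (-1) ^ (t - s) * of_nat (t choose s) * g (x0 + of_nat s * h))
      \<le> (\<Sum>s=0..t. norm ((-1) ^ (t - s) * of_nat (t choose s) * g (x0 + of_nat s * h)))"
    by (rule norm_sum)
  also have "\<dots> \<le> (\<Sum>s=0..t. real (t choose s) * (\<epsilon> * norm (of_nat s * h) ^ t))"
    using le by (intro sum_mono) (auto simp: norm_mult norm_power intro!: mult_left_mono)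
  also have "\<dots> = norm h ^ t * (\<epsilon> * (\<Sum>s=0..t. real (t choose s) * real s ^ t))"
    by (simp add: norm_mult power_mult_distrib sum_distrib_left mult_ac)
  finally have "norm (\<Sum>s=0..t. (-1) ^ (t - s) * of_nat (t choose s) * g (x0 + of_nat s * h)) / norm h ^ t
      \<le> \<epsilon> * (\<Sum>s=0..t. real (t choose s) * real s ^ t)"
    using assms(1) by (simp add: divide_le_eq mult.commute)
  then show ?thesis
    by (simp add: diff_quotient_def norm_mult norm_inverse norm_power divide_inverse mult.commute)
qed

theorem theorem1p2:
  fixes X :: "complex set" and x0 :: complex and t :: nat and p :: real
    and f :: "complex \<Rightarrow> complex"
  assumes "compact X" and "interior X = {}" and "x0 \<in> X"
    and "t \<ge> 1" and "2 < p"
    and "has_bounded_point_derivation X p t x0"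
    and "f \<in> Rp X p"
  shows "\<exists>E'. full_area_density_at_0 E' \<and>
           (\<forall>h\<in>E'. \<forall>s\<in>{1..t}. x0 + of_nat s * h \<in> X) \<and>
           ((\<lambda>h. norm (diff_quotient t h (f(x0 := point_derivation X p 0 x0 f)) x0
                       - point_derivation X p t x0 f)) \<longlongrightarrow> 0) (at 0 within E')"
proof -
  have p: "2 \<le> p" "1 < p" using assms(5) by auto
  obtain K where "K \<in> borel_measurable (lebesgue_on X)" "integrable (lebesgue_on X) (\<lambda>z. norm (K z) powr (p / (p - 1)))"
    "\<And>F. F \<in> rational_near X \<Longrightarrow> (LINT z|lebesgue_on X. F z * K z) = (deriv ^^ t) F x0 / fact t"
    using bounded_point_derivation_representation[OF assms(1,3) p(1) assms(6)] by blast
  then interpret derivation_kernel X x0 t p K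
    using assms(1,3) p(2) by unfold_locales
  obtain E where E: "density_point E x0" "E \<subseteq> X" "x0 \<notin> E"
    "\<And>\<epsilon>. \<epsilon> > 0 \<Longrightarrow> \<exists>r>0. \<forall>y \<in> E \<inter> ball x0 r. norm (f y - taylor_poly f y) \<le> \<epsilon> * norm (y - x0) ^ t"
    using Rp_approximate_taylor_expansion[OF assms(7)] by blast
  define f' where "f' = f(x0 := point_derivation X p 0 x0 f)"
  \<comment> \<open>All the points $x_0 + sh$ have to lie in the good set, so its rescaled copies are intersected.\<close>
  define E' where "E' = (\<Inter>s\<in>{1..t}. {h. x0 + of_real (real s) * h \<in> E})"
  have f'0: "f' x0 = taylor_poly f x0"
  proof -
    have "taylor_poly f x0 = (\<Sum>m\<le>t. if m = 0 then taylor_coeff f 0 else 0)"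
      unfolding taylor_poly_def by (intro sum.cong refl) auto
    then show ?thesis by (simp add: f'_def point_derivation_eq[OF assms(7)])
  qed
  have E'E: "x0 + of_nat s * h \<in> E" if "h \<in> E'" "s \<in> {1..t}" for h s
    using that by (auto simp: E'_def)
  have "density_point E' 0"
    unfolding E'_def using assms(4) by (intro density_point_INT density_point_scale E(1)) auto
  then have "full_area_density_at_0 E'" by (rule density_point_imp_full_area_density)
  moreover have "\<forall>h\<in>E'. \<forall>s\<in>{1..t}. x0 + of_nat s * h \<in> X" using E'E E(2) by blast
  moreover have "((\<lambda>h. norm (diff_quotient t h f' x0 - point_derivation X p t x0 f)) \<longlongrightarrow> 0) (at 0 within E')"
  proof (rule tendstoI)
    fix e :: real assume e: "e > 0"
    define C where "C = (\<Sum>s=0..t. real (t choose s) * real s ^ t)"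
    have C: "C \<ge> 0" by (simp add: C_def sum_nonneg)
    define \<epsilon> where "\<epsilon> = e / (C + 1)"
    have \<epsilon>: "\<epsilon> > 0" using e C by (simp add: \<epsilon>_def)
    have "\<epsilon> * C < \<epsilon> * (C + 1)" using \<epsilon> by simp
    also have "\<epsilon> * (C + 1) = e" using C by (simp add: \<epsilon>_def)
    finally have \<epsilon>C: "\<epsilon> * C < e" .
    obtain r where r: "r > 0" "\<And>y. y \<in> E \<inter> ball x0 r \<Longrightarrow> norm (f y - taylor_poly f y) \<le> \<epsilon> * norm (y - x0) ^ t"
      using E(4)[OF \<epsilon>] by blast
    have bound: "norm (diff_quotient t h f' x0 - point_derivation X p t x0 f) < e"
      if h: "h \<in> E'" "h \<noteq> 0" "norm h < r / real t" for h
    proof -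
      have "point_derivation X p t x0 f = diff_quotient t h (taylor_poly f) x0"
        using diff_quotient_polynomial[OF h(2), of t x0 "taylor_coeff f"] point_derivation_eq[OF assms(7) order_refl]
        by (simp add: taylor_poly_def[abs_def])
      then have "diff_quotient t h f' x0 - point_derivation X p t x0 f = diff_quotient t h (\<lambda>y. f' y - taylor_poly f y) x0"
        by (simp only: diff_quotient_diff)
      moreover have "norm (diff_quotient t h (\<lambda>y. f' y - taylor_poly f y) x0) \<le> \<epsilon> * C"
        unfolding C_def
      proof (rule norm_diff_quotient_le)
        fix s assume s: "s \<le> t"
        show "norm (f' (x0 + of_nat s * h) - taylor_poly f (x0 + of_nat s * h)) \<le> \<epsilon> * norm (of_nat s * h) ^ t"
        proof (cases "s = 0")
          case True
          then show ?thesis using f'0 \<epsilon> by simp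
        next
          case False
          then have yE: "x0 + of_nat s * h \<in> E" using s by (intro E'E h(1)) auto
          have "norm (of_nat s * h) \<le> real t * norm h"
            using s by (simp add: norm_mult mult_right_mono)
          also have "\<dots> < r" using h(3) assms(4) by (simp add: field_simps)
          finally have "x0 + of_nat s * h \<in> E \<inter> ball x0 r" using yE by (simp add: dist_norm)
          moreover have "x0 + of_nat s * h \<noteq> x0" using False h(2) by simp
          ultimately show ?thesis using r(2)[of "x0 + of_nat s * h"] by (simp add: f'_def)
        qed
      qed (use \<epsilon> h in auto)
      ultimately show ?thesis using \<epsilon>C by simp
    qed
    show "\<forall>\<^sub>F h in at 0 within E'. dist (norm (diff_quotient t h f' x0 - point_derivation X p t x0 f)) 0 < e"
      unfolding eventually_at using r(1) assms(4) bound
      by (intro exI[of _ "r / real t"]) (auto simp: dist_norm)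
  qed
  ultimately show ?thesis unfolding f'_def by blast
qed

end
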